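(* Let $k\in\mathbb N$ and let $\mathcal K$ be a proper missing-digit fractal in $[0,1]^k$ whose Cantor--Lebesgue measure $\mu$ satisfies \[ \dim_{\ell^1}(\mu)>k-\frac{k}{k+1}. \] Then there exists a constant $\eta>0$ such that for every $c>0$ there are $Q_0\geqslant1$ and constants $0<C_1\leqslant C_2$ (depending on $\mathcal K$ and $c$) with \[ C_1\,\delta^{k-\dim_{\mathrm H}(\mathcal K)}Q^{\dim_{\mathrm H}(\mathcal K)+1}\leqslant \#\mathcal N_{\mathcal K}(Q,\delta)\leqslant C_2\,\delta^{k-\dim_{\mathrm H}(\mathcal K)}Q^{\dim_{\mathrm H}(\mathcal K)+1} \] for all $Q\geqslant Q_0$ and all $\delta\in(0,1)$ with $\delta\geqslant cQ^{-\eta-1/k}$.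
   Context: A missing-digit fractal is a set $\mathcal K_{b,\mathcal D}=\{\sum_{j\geqslant1}\mathbf d^{(j)}b^{-j}:\mathbf d^{(j)}\in\mathcal D\}\subseteq[0,1]^k$ with integers $b\geqslant2$ and nonempty $\mathcal D\subseteq\{0,1,\dots,b-1\}^k$; its Cantor--Lebesgue measure is the law of $\sum_{j\geqslant1}\mathbf d^{(j)}b^{-j}$ with $\mathbf d^{(j)}$ i.i.d. uniform on $\mathcal D$. It is proper if $\#\mathcal K\geqslant2$ and $\mathcal K\neq[0,1]^k$. $\dim_{\mathrm H}$ is Hausdorff dimension. For a Borel probability measure $\nu$ on $[0,1]^k$, $\hat\nu({\boldsymbol{\xi}})=\int e^{-2\pi i{\boldsymbol{\xi}}\cdot\mathbf x}\,d\nu(\mathbf x)$ and $\dim_{\ell^1}(\nu)=\sup\{s\geqslant0:\sum_{{\boldsymbol{\xi}}\in\mathbb Z^k,\|{\boldsymbol{\xi}}\|_\infty\leqslant Q}|\hat\nu({\boldsymbol{\xi}})|\ll Q^{k-s}\ (Q\geqslant1)\}$. For compact $\mathcal K\subset\mathbb R^k$, $Q\geqslant1$ and $\delta\geqslant0$, \[ \mathcal N_{\mathcal K}(Q,\delta)=\{(\mathbf a,q)\in\mathbb Z^k\times(\mathbb Z\cap[1,Q]):\ \mathrm{dist}(\mathbf a/q,\mathcal K)\leqslant\delta/Q\}. \] *)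

theory Defs
  imports "HOL-Probability.Probability"
begin

definition digit_vec :: "nat ^ 'n \<Rightarrow> real ^ 'n" where
  "digit_vec d = (\<chi> i. real (d $ i))"

definition digit_sum :: "nat \<Rightarrow> (nat \<Rightarrow> nat ^ 'n) \<Rightarrow> real ^ 'n" where
  "digit_sum b d = (\<Sum>j. (real b) powi (- int (Suc j)) *\<^sub>R digit_vec (d j))"

definition missing_digit_fractal :: "nat \<Rightarrow> (nat ^ 'n) set \<Rightarrow> (real ^ 'n) set" where
  "missing_digit_fractal b D = {digit_sum b d | d. \<forall>j. d j \<in> D}"

definition cantor_lebesgue :: "nat \<Rightarrow> (nat ^ 'n) set \<Rightarrow> (real ^ 'n) measure" where
  "cantor_lebesgue b D =
     distr (PiM (UNIV :: nat set) (\<lambda>_. measure_pmf (pmf_of_set D))) borel (digit_sum b)"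

definition unit_cube :: "(real ^ 'n) set" where
  "unit_cube = {x. \<forall>i. 0 \<le> x $ i \<and> x $ i \<le> 1}"

definition proper_fractal :: "(real ^ 'n) set \<Rightarrow> bool" where
  "proper_fractal K \<longleftrightarrow> (\<exists>x\<in>K. \<exists>y\<in>K. x \<noteq> y) \<and> K \<noteq> unit_cube"

definition fourier_coeff :: "(real ^ 'n) measure \<Rightarrow> int ^ 'n \<Rightarrow> complex" where
  "fourier_coeff \<nu> \<xi> =
     (LINT x|\<nu>. exp (- 2 * pi * \<i> * complex_of_real (\<Sum>i\<in>UNIV. real_of_int (\<xi> $ i) * x $ i)))"

definition int_box :: "real \<Rightarrow> (int ^ 'n) set" where
  "int_box Q = {\<xi>. \<forall>i. real_of_int \<bar>\<xi> $ i\<bar> \<le> Q}"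

definition l1_dim :: "(real ^ 'n) measure \<Rightarrow> real" where
  "l1_dim \<nu> = Sup {s. s \<ge> 0 \<and> (\<exists>C. \<forall>Q::real. Q \<ge> 1 \<longrightarrow>
       (\<Sum>\<xi>\<in>int_box Q. cmod (fourier_coeff \<nu> \<xi>)) \<le> C * Q powr (real CARD('n) - s))}"

definition hausdorff_approx :: "real \<Rightarrow> real \<Rightarrow> 'a::metric_space set \<Rightarrow> ennreal" where
  "hausdorff_approx s \<delta> E = (INF U \<in> {U :: nat \<Rightarrow> 'a set. E \<subseteq> (\<Union>i. U i) \<and>
        (\<forall>i. bounded (U i) \<and> diameter (U i) \<le> \<delta>)}.
      (\<Sum>i. ennreal (diameter (U i) powr s)))"

definition hausdorff_measure :: "real \<Rightarrow> 'a::metric_space set \<Rightarrow> ennreal" where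
  "hausdorff_measure s E = (SUP \<delta> \<in> {0<..}. hausdorff_approx s \<delta> E)"

definition hausdorff_dim :: "'a::metric_space set \<Rightarrow> real" where
  "hausdorff_dim E = Inf {s. s \<ge> 0 \<and> hausdorff_measure s E = 0}"

definition rat_points_near :: "(real ^ 'n) set \<Rightarrow> real \<Rightarrow> real \<Rightarrow> ((int ^ 'n) \<times> int) set" where
  "rat_points_near K Q \<delta> = {(a, q). 1 \<le> q \<and> real_of_int q \<le> Q \<and>
      infdist ((\<chi> i. real_of_int (a $ i) / real_of_int q)) K \<le> \<delta> / Q}"

end

theory Submission
  imports Defs "HOL-Computational_Algebra.Primes"
begin

text \<open>
  Let \<open>\<mu>\<close> be the Cantor--Lebesgue measure, \<open>\<kappa> = log #D / log b\<close> and \<open>r = \<delta> / Q\<close>. Since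
  \<open>\<mu>(B(y, r)) \<asymp> r\<^sup>\<kappa>\<close> on the fractal, whose dimension is therefore \<open>\<kappa>\<close>, the count is comparable to
  \<open>r\<close> to the power \<open>-\<kappa>\<close> times the \<open>\<mu>\<close>-average of the number of rationals \<open>a/q\<close> with \<open>q \<le> Q\<close> at
  distance \<open>\<lesssim> r\<close> from a point. For fixed \<open>q\<close> the condition says that \<open>q x\<close> is within \<open>\<lesssim> \<delta>\<close> of an
  integer point, and its indicator is sandwiched between trigonometric polynomials in \<open>q x\<close> of
  degree \<open>\<asymp> 1/\<delta>\<close> with mean \<open>\<asymp> \<delta>\<^sup>k\<close> and coefficients \<open>O(\<delta>\<^sup>k)\<close>. The zero frequencies contribute
  \<open>\<asymp> \<delta>\<^sup>k Q\<close>. A nonzero frequency \<open>\<xi>\<close> arises from at most as many \<open>q\<close> as \<open>\<xi>\<close> has divisors, so by the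
  divisor bound the remaining terms are at most \<open>\<delta>\<^sup>k\<close> times \<open>Q / \<delta>\<close> to some power
  \<open>\<theta> < k / (k + 1)\<close>. This is \<open>o(\<delta>\<^sup>k Q)\<close> as long as \<open>\<delta>\<close> is not much smaller than \<open>Q\<close> to the
  power \<open>-1/k - \<eta>\<close>.
\<close>

section \<open>Divisor bound and sums over multiples\<close>

text \<open>The hypothesis on \<open>l1_dim\<close> is matched to the critical scale: at \<delta> =
  Q to the power -1/k the frequencies reach Q / \<delta>, which is Q to the power 1 + 1/k, and its
  \<theta>-th power is o(Q) exactly when \<theta> (1 + 1/k) < 1, that is \<theta> < k / (k + 1).
  Strictness leaves room both for the divisor bound and for a positive \<eta>. The Fourier
  coefficient of \<mu> at b \<xi> equals the one at \<xi>, so there is no pointwise decay to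
  exploit; the error can only be controlled after summing over all q. The two counts use opposite
  halves of the mass estimate. In the upper count each rational has a point of K nearby, at which
  the mass is bounded below. In the lower count the mass is bounded above around the rational
  itself, which may lie off K, so that bound must hold for every centre. The lower count uses only q
  \<ge> Q / 2: for such q, closeness of q x to an integer vector at scale \<delta> brings a/q within
  \<delta> / Q of x, whereas small q would need a smaller tolerance.\<close>

lemma card_divisors_prime_power_mult_le:
  fixes p m a :: nat
  assumes "prime p" "m > 0"
  shows "card {q. q dvd p ^ a * m} \<le> Suc a * card {q. q dvd m}"
proof -
  have fin: "finite {q. q dvd m}" using assms by simp
  have "{q. q dvd p ^ a * m} \<subseteq> (\<lambda>(i, e). p ^ i * e) ` ({..a} \<times> {q. q dvd m})"
  proof
    fix q assume "q \<in> {q. q dvd p ^ a * m}"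
    then obtain u e where q: "q = u * e" "u dvd p ^ a" "e dvd m"
      using division_decomp[of q "p ^ a" m] by auto
    then obtain i where "i \<le> a" "u = p ^ i"
      using divides_primepow_nat[OF assms(1)] by blast
    then show "q \<in> (\<lambda>(i, e). p ^ i * e) ` ({..a} \<times> {q. q dvd m})"
      using q by (intro image_eqI[of _ _ "(i, e)"]) auto
  qed
  then have "card {q. q dvd p ^ a * m} \<le> card ((\<lambda>(i, e). p ^ i * e) ` ({..a} \<times> {q. q dvd m}))"
    using fin by (intro card_mono) auto
  also have "\<dots> \<le> card ({..a} \<times> {q. q dvd m})"
    using fin by (intro card_image_le) auto
  finally show ?thesis by (simp add: card_cartesian_product)
qed

text \<open>A prime power contributes a + 1 divisors, to be compared with
  \<open>(p ^ a) powr \<epsilon>\<close>. From \<open>exp (1 / \<epsilon>)\<close> on this needs no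
  constant; each of the finitely many smaller primes costs one factor \<open>B\<close>.\<close>

lemma divisor_bound:
  fixes \<epsilon> :: real
  assumes "\<epsilon> > 0"
  shows "\<exists>C>0. \<forall>n::nat. n > 0 \<longrightarrow> real (card {q. q dvd n}) \<le> C * real n powr \<epsilon>"
proof -
  \<comment> \<open>Chosen so that B (1 + a \<epsilon> ln 2) \<ge> 1 + a for every a, which settles
    the smallest possible prime 2 and hence all others.\<close>
  define B where "B = 1 + 1 / (\<epsilon> * ln 2)"
  define S where "S = {p::nat. prime p \<and> real p < exp (1 / \<epsilon>)}"
  have B1: "B \<ge> 1" using assms by (simp add: B_def)
  have "S \<subseteq> {..nat \<lceil>exp (1 / \<epsilon>)\<rceil>}"
  proof
    fix p assume "p \<in> S"
    then have "real p < exp (1 / \<epsilon>)" by (simp add: S_def)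
    then have "real p \<le> real (nat \<lceil>exp (1 / \<epsilon>)\<rceil>)" by linarith
    then show "p \<in> {..nat \<lceil>exp (1 / \<epsilon>)\<rceil>}" by simp
  qed
  then have finS: "finite S" using finite_subset by blast
  have small: "real (Suc a) \<le> B * real (p ^ a) powr \<epsilon>" if "prime p" for a p :: nat
  proof -
    have p2: "real p \<ge> 2" using prime_ge_2_nat[OF that] by simp
    have "1 + real a * \<epsilon> * ln 2 \<le> exp (real a * \<epsilon> * ln 2)"
      using exp_ge_add_one_self by blast
    also have "\<dots> \<le> exp (real a * \<epsilon> * ln (real p))"
      using p2 assms by (simp add: mult_left_mono)
    also have "\<dots> = real (p ^ a) powr \<epsilon>"
      using p2 by (simp add: powr_def ln_realpow mult_ac)
    finally have le: "1 + real a * \<epsilon> * ln 2 \<le> real (p ^ a) powr \<epsilon>" .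
    have "real (Suc a) \<le> B * (1 + real a * \<epsilon> * ln 2)"
      using assms by (simp add: B_def field_simps)
    also have "\<dots> \<le> B * real (p ^ a) powr \<epsilon>"
      using le B1 by (intro mult_left_mono) auto
    finally show ?thesis .
  qed
  have large: "real (Suc a) \<le> real (p ^ a) powr \<epsilon>" if "prime p" "p \<notin> S" for a p :: nat
  proof -
    have ge: "exp (1 / \<epsilon>) \<le> real p" using that by (simp add: S_def)
    have p0: "real p > 0" using ge exp_gt_zero[of "1/\<epsilon>"] by linarith
    have "1 / \<epsilon> \<le> ln (real p)" using ge p0 by (simp add: ln_ge_iff)
    then have le: "1 \<le> \<epsilon> * ln (real p)" using assms by (simp add: field_simps)
    have "1 + real a \<le> exp (real a)" using exp_ge_add_one_self by blast
    also have "\<dots> \<le> exp (real a * (\<epsilon> * ln (real p)))"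
      using le by (simp add: mult_le_cancel_left1)
    also have "\<dots> = real (p ^ a) powr \<epsilon>"
      using p0 by (simp add: powr_def ln_realpow mult_ac)
    finally show ?thesis by simp
  qed
  \<comment> \<open>The induction strips off a full prime power at a time. The exponent of
    \<open>B\<close> counts only the small primes dividing \<open>n\<close>, so it never exceeds
    \<open>card S\<close>.\<close>
  have main: "real (card {q. q dvd n}) \<le> B ^ card {p\<in>S. p dvd n} * real n powr \<epsilon>" if "n > 0" for n :: nat
    using that
  proof (induction n rule: less_induct)
    case (less n)
    show ?case
    proof (cases "n = 1")
      case True
      then show ?thesis by (simp add: B1)
    next
      case False
      then obtain p where p: "prime p" "p dvd n" using prime_factor_nat by blast
      obtain m where m: "n = p ^ multiplicity p n * m" "\<not> p dvd m"
        using multiplicity_decompose'[of n p] p less.prems by (metis gr0_conv_Suc not_prime_unit nat.simps(3))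
      define a where "a = multiplicity p n"
      have n: "n = p ^ a * m" using m by (simp add: a_def)
      have m0: "m > 0" using n less.prems by (cases m) auto
      have "a > 0" using p(2) m(2) n by (cases a) auto
      then have "p ^ a > 1" using p(1) prime_gt_1_nat one_less_power by blast
      then have mn: "m < n" using n m0 by simp
      have IH: "real (card {q. q dvd m}) \<le> B ^ card {p\<in>S. p dvd m} * real m powr \<epsilon>"
        using less.IH[OF mn m0] .
      have "real (card {q. q dvd n}) \<le> real (Suc a) * real (card {q. q dvd m})"
        using card_divisors_prime_power_mult_le[OF p(1) m0, of a] n by (metis of_nat_le_iff of_nat_mult)
      also have "\<dots> \<le> real (Suc a) * (B ^ card {p\<in>S. p dvd m} * real m powr \<epsilon>)"
        using IH by (intro mult_left_mono) auto
      also have "\<dots> \<le> B ^ card {p\<in>S. p dvd n} * real n powr \<epsilon>"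
      proof (cases "p \<in> S")
        case True
        have "insert p {p\<in>S. p dvd m} \<subseteq> {p\<in>S. p dvd n}" using True p n by auto
        then have "card (insert p {p\<in>S. p dvd m}) \<le> card {p\<in>S. p dvd n}"
          using finS by (intro card_mono) auto
        then have c: "Suc (card {p\<in>S. p dvd m}) \<le> card {p\<in>S. p dvd n}" using m(2) finS by simp
        have "real (Suc a) * (B ^ card {p\<in>S. p dvd m} * real m powr \<epsilon>)
          \<le> (B * real (p ^ a) powr \<epsilon>) * (B ^ card {p\<in>S. p dvd m} * real m powr \<epsilon>)"
          using small[OF p(1)] B1 by (intro mult_right_mono) auto
        also have "\<dots> = B ^ Suc (card {p\<in>S. p dvd m}) * real n powr \<epsilon>"
          by (simp add: n powr_mult)
        also have "\<dots> \<le> B ^ card {p\<in>S. p dvd n} * real n powr \<epsilon>"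
          using power_increasing[OF c B1] by (intro mult_right_mono) auto
        finally show ?thesis .
      next
        case False
        have "{p\<in>S. p dvd m} \<subseteq> {p\<in>S. p dvd n}" using n by auto
        then have c: "card {p\<in>S. p dvd m} \<le> card {p\<in>S. p dvd n}"
          using finS by (intro card_mono) auto
        have "real (Suc a) * (B ^ card {p\<in>S. p dvd m} * real m powr \<epsilon>)
          \<le> real (p ^ a) powr \<epsilon> * (B ^ card {p\<in>S. p dvd m} * real m powr \<epsilon>)"
          using large[OF p(1) False] B1 by (intro mult_right_mono) auto
        also have "\<dots> = B ^ card {p\<in>S. p dvd m} * real n powr \<epsilon>"
          by (simp add: n powr_mult)
        also have "\<dots> \<le> B ^ card {p\<in>S. p dvd n} * real n powr \<epsilon>"
          using power_increasing[OF c B1] by (intro mult_right_mono) auto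
        finally show ?thesis .
      qed
      finally show ?thesis .
    qed
  qed
  show ?thesis
  proof (intro exI[of _ "B ^ card S"] conjI allI impI)
    show "B ^ card S > 0" using B1 by simp
    fix n :: nat assume "n > 0"
    have "card {p\<in>S. p dvd n} \<le> card S" using finS by (intro card_mono) auto
    then have "B ^ card {p\<in>S. p dvd n} * real n powr \<epsilon> \<le> B ^ card S * real n powr \<epsilon>"
      using power_increasing[OF _ B1] by (intro mult_right_mono) auto
    with main[OF \<open>n > 0\<close>] show "real (card {q. q dvd n}) \<le> B ^ card S * real n powr \<epsilon>" by linarith
  qed
qed

section \<open>Integer boxes and regrouping of multiples\<close>

lemma vec_box_eq_image:
  "{\<xi>::'a ^ 'n. \<forall>i. \<xi> $ i \<in> A i} = vec_lambda ` (PiE UNIV A)"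
proof
  show "{\<xi>::'a ^ 'n. \<forall>i. \<xi> $ i \<in> A i} \<subseteq> vec_lambda ` (PiE UNIV A)"
  proof
    fix \<xi> :: "'a ^ 'n" assume "\<xi> \<in> {\<xi>. \<forall>i. \<xi> $ i \<in> A i}"
    then show "\<xi> \<in> vec_lambda ` (PiE UNIV A)"
      by (intro image_eqI[of _ _ "\<lambda>i. \<xi> $ i"]) auto
  qed
qed (auto simp: PiE_iff)

lemma inj_on_vec_lambda: "inj_on (vec_lambda :: _ \<Rightarrow> 'a ^ 'n) S"
  by (auto simp: inj_on_def vec_lambda_inject)

lemma finite_vec_box:
  assumes "\<And>i. finite (A i)"
  shows "finite {\<xi>::'a ^ 'n. \<forall>i. \<xi> $ i \<in> A i}"
  using assms by (simp add: vec_box_eq_image finite_PiE)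

lemma card_vec_box:
  assumes "\<And>i. finite (A i)"
  shows "card {\<xi>::'a ^ 'n. \<forall>i. \<xi> $ i \<in> A i} = (\<Prod>i\<in>UNIV. card (A i))"
  by (simp add: vec_box_eq_image card_image inj_on_vec_lambda card_PiE)

lemma int_box_eq: "int_box Q = {\<xi>::int ^ 'n. \<forall>i. \<xi> $ i \<in> {-\<lfloor>Q\<rfloor>..\<lfloor>Q\<rfloor>}}"
proof -
  have "real_of_int \<bar>z\<bar> \<le> Q \<longleftrightarrow> z \<in> {-\<lfloor>Q\<rfloor>..\<lfloor>Q\<rfloor>}" for z :: int
    using le_floor_iff[of "\<bar>z\<bar>" Q] by auto
  then show ?thesis unfolding int_box_def by blast
qed

lemma finite_int_box [simp]: "finite (int_box Q)"
  unfolding int_box_eq by (rule finite_vec_box) auto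

lemma int_box_mono: "Q \<le> R \<Longrightarrow> int_box Q \<subseteq> int_box R"
  unfolding int_box_def using order_trans by blast

lemma card_int_box_le:
  assumes "Q \<ge> 1"
  shows "real (card (int_box Q :: (int ^ 'n) set)) \<le> (3 * Q) ^ CARD('n)"
proof -
  have "real (card (int_box Q :: (int ^ 'n) set)) = real (card {-\<lfloor>Q\<rfloor>..\<lfloor>Q\<rfloor>}) ^ CARD('n)"
    unfolding int_box_eq by (subst card_vec_box) auto
  also have "\<dots> \<le> (3 * Q) ^ CARD('n)"
  proof (rule power_mono)
    show "real (card {-\<lfloor>Q\<rfloor>..\<lfloor>Q\<rfloor>}) \<le> 3 * Q" using assms by simp linarith
  qed auto
  finally show ?thesis .
qed

text \<open>Regroup the pairs (q, m) by \<xi> = q m. Since m is nonzero, some coordinate of \<xi> is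
  nonzero and q divides it; that coordinate is at most Q M in size, so the divisor bound limits
  every fibre. Nonnegativity of \<open>A\<close> allows the remaining \<xi> of the box to be added
  at the end.\<close>

lemma sum_multiples_le_divisor_weighted_sum:
  fixes A :: "int ^ 'n \<Rightarrow> real"
  assumes A: "\<And>\<xi>. A \<xi> \<ge> 0"
    and d: "\<And>n::nat. n > 0 \<Longrightarrow> real (card {q. q dvd n}) \<le> C * real n powr \<epsilon>"
    and C: "C > 0" and e: "\<epsilon> > 0" and Q: "Q \<ge> 1" and M: "M \<ge> 1"
  shows "(\<Sum>q\<in>{1..\<lfloor>Q\<rfloor>}. \<Sum>m\<in>int_box M - {0}. A (q *s m))
    \<le> C * (Q * M) powr \<epsilon> * (\<Sum>\<xi>\<in>int_box (Q * M). A \<xi>)"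
proof -
  define T :: "(int \<times> (int ^ 'n)) set" where "T = {1..\<lfloor>Q\<rfloor>} \<times> (int_box M - {0})"
  define g :: "int \<times> (int ^ 'n) \<Rightarrow> int ^ 'n" where "g = (\<lambda>(q, m). q *s m)"
  have finT: "finite T" by (simp add: T_def)
  have gT: "g ` T \<subseteq> int_box (Q * M)"
  proof
    fix \<xi> assume "\<xi> \<in> g ` T"
    then obtain q m where q: "1 \<le> q" "q \<le> \<lfloor>Q\<rfloor>" and m: "m \<in> int_box M" and \<xi>: "\<xi> = q *s m"
      unfolding T_def g_def by fastforce
    have "real_of_int \<bar>q * m $ i\<bar> \<le> Q * M" for i
    proof -
      have "real_of_int \<bar>q\<bar> \<le> Q" using q by linarith
      moreover have "real_of_int \<bar>m $ i\<bar> \<le> M" using m by (simp add: int_box_def)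
      ultimately show ?thesis
        using Q M by (simp add: abs_mult mult_mono)
    qed
    then show "\<xi> \<in> int_box (Q * M)" by (simp add: int_box_def \<xi>)
  qed
  have card: "real (card {x\<in>T. g x = \<xi>}) \<le> C * (Q * M) powr \<epsilon>" if \<xi>: "\<xi> \<in> g ` T" for \<xi>
  proof -
    obtain q m where qm: "(q, m) \<in> T" "\<xi> = q *s m" using \<xi> unfolding g_def by fastforce
    obtain i where i: "m $ i \<noteq> 0" using qm by (auto simp: T_def vec_eq_iff)
    have nz: "\<xi> $ i \<noteq> 0" using i qm by (auto simp: T_def)
    define n where "n = nat \<bar>\<xi> $ i\<bar>"
    have n0: "n > 0" using nz by (simp add: n_def)
    \<comment> \<open>As q \<ge> 1, the vector \<xi> and q determine m, so q alone labels the
      elements of a fibre.\<close>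
    have inj: "inj_on (\<lambda>x. nat (fst x)) {x\<in>T. g x = \<xi>}"
    proof (rule inj_onI)
      fix x y assume xy: "x \<in> {x\<in>T. g x = \<xi>}" "y \<in> {x\<in>T. g x = \<xi>}" "nat (fst x) = nat (fst y)"
      have q: "fst x \<ge> 1" "fst y \<ge> 1" using xy by (auto simp: T_def)
      then have eq: "fst x = fst y" using xy(3) by linarith
      have "fst x *s snd x = fst y *s snd y" using xy by (simp add: g_def case_prod_unfold)
      then have "fst x * snd x $ i = fst x * snd y $ i" for i
        using eq by (metis vector_smult_component)
      then have "snd x = snd y" using q by (simp add: vec_eq_iff)
      with eq show "x = y" by (simp add: prod_eq_iff)
    qed
    have "(\<lambda>x. nat (fst x)) ` {x\<in>T. g x = \<xi>} \<subseteq> {q. q dvd n}"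
    proof (rule image_subsetI)
      fix x assume x: "x \<in> {x\<in>T. g x = \<xi>}"
      then have "\<xi> $ i = fst x * snd x $ i" by (auto simp: g_def case_prod_unfold)
      moreover have "fst x \<ge> 1" using x by (auto simp: T_def)
      ultimately show "nat (fst x) \<in> {q. q dvd n}" by (simp add: n_def abs_mult nat_mult_distrib)
    qed
    then have "card {x\<in>T. g x = \<xi>} \<le> card {q. q dvd n}"
      using card_inj_on_le[OF inj] n0 by simp
    then have "real (card {x\<in>T. g x = \<xi>}) \<le> C * real n powr \<epsilon>"
      using d[OF n0] by linarith
    also have "\<dots> \<le> C * (Q * M) powr \<epsilon>"
    proof (intro mult_left_mono powr_mono2)
      have "real_of_int \<bar>\<xi> $ i\<bar> \<le> Q * M" using gT \<xi> by (auto simp: int_box_def)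
      then show "real n \<le> Q * M" by (simp add: n_def)
    qed (use C e in auto)
    finally show ?thesis .
  qed
  have "(\<Sum>q\<in>{1..\<lfloor>Q\<rfloor>}. \<Sum>m\<in>int_box M - {0}. A (q *s m)) = (\<Sum>x\<in>T. A (g x))"
    by (simp add: T_def g_def sum.cartesian_product case_prod_unfold)
  also have "\<dots> = (\<Sum>\<xi>\<in>g ` T. \<Sum>x\<in>{x\<in>T. g x = \<xi>}. A (g x))"
    by (rule sum.image_gen[OF finT])
  also have "\<dots> = (\<Sum>\<xi>\<in>g ` T. real (card {x\<in>T. g x = \<xi>}) * A \<xi>)"
    by (intro sum.cong refl) simp
  also have "\<dots> \<le> (\<Sum>\<xi>\<in>g ` T. C * (Q * M) powr \<epsilon> * A \<xi>)"
    using card A by (intro sum_mono mult_right_mono) auto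
  also have "\<dots> = C * (Q * M) powr \<epsilon> * (\<Sum>\<xi>\<in>g ` T. A \<xi>)"
    by (simp add: sum_distrib_left)
  also have "\<dots> \<le> C * (Q * M) powr \<epsilon> * (\<Sum>\<xi>\<in>int_box (Q * M). A \<xi>)"
    using gT A C by (intro mult_left_mono sum_mono2) auto
  finally show ?thesis .
qed

section \<open>Trigonometric polynomials\<close>

text \<open>The sign is opposite to that in \<open>fourier_coeff\<close>; only moduli of
  expectations are compared, and conjugation preserves them.\<close>

definition ech :: "int ^ 'n \<Rightarrow> real ^ 'n \<Rightarrow> complex" where
  "ech \<xi> x = cis (2 * pi * (\<Sum>i\<in>UNIV. real_of_int (\<xi> $ i) * x $ i))"

definition tpoly :: "(int ^ 'n) set \<Rightarrow> (int ^ 'n \<Rightarrow> real) \<Rightarrow> real ^ 'n \<Rightarrow> complex" where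
  "tpoly J u x = (\<Sum>j\<in>J. of_real (u j) * ech j x)"

text \<open>One-sided frequencies: a product f cnj(g) of two such polynomials has the differences as
  frequencies, and these fill the symmetric box \<open>int_box\<close>.\<close>

definition nbox :: "nat \<Rightarrow> (int ^ 'n) set" where
  "nbox M = {j. \<forall>i. j $ i \<in> {0..int M}}"

lemma norm_ech [simp]: "norm (ech \<xi> x) = 1"
  by (simp add: ech_def)

lemma ech_0 [simp]: "ech 0 x = 1"
  by (simp add: ech_def)

lemma ech_diff: "ech (j - l) x = ech j x * cnj (ech l x)"
  by (simp add: ech_def cis_cnj cis_mult sum_subtractf algebra_simps)

lemma ech_scale: "ech j (of_int q *\<^sub>R x) = ech (q *s j) x"
  by (simp add: ech_def mult_ac)

lemma ech_diff_int:
  "ech j (x - (\<chi> i. real_of_int (a $ i))) = ech j x"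
proof -
  have "cis (- (2 * pi * (\<Sum>i\<in>UNIV. real_of_int (j $ i) * real_of_int (a $ i)))) = 1"
    using cis_multiple_2pi[of "- (real_of_int (\<Sum>i\<in>UNIV. j $ i * a $ i))"]
    by (simp add: Ints_sum Ints_mult)
  moreover have "ech j (x - (\<chi> i. real_of_int (a $ i)))
    = ech j x * cis (- (2 * pi * (\<Sum>i\<in>UNIV. real_of_int (j $ i) * real_of_int (a $ i))))"
    by (simp add: ech_def cis_mult sum_subtractf algebra_simps)
  ultimately show ?thesis by simp
qed

lemma continuous_on_ech [continuous_intros]: "continuous_on S (ech \<xi>)"
  unfolding ech_def cis_conv_exp by (intro continuous_intros)

lemma ech_measurable [measurable]: "ech \<xi> \<in> borel_measurable borel"
  by (intro borel_measurable_continuous_onI continuous_intros)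

lemma tpoly_measurable [measurable]: "tpoly J u \<in> borel_measurable borel"
  unfolding tpoly_def[abs_def] by measurable

lemma finite_nbox [simp]: "finite (nbox M)"
  unfolding nbox_def by (rule finite_vec_box) auto

lemma nbox_diff_in_int_box: "j \<in> nbox M \<Longrightarrow> l \<in> nbox M \<Longrightarrow> j - l \<in> int_box (real M)"
proof -
  assume "j \<in> nbox M" "l \<in> nbox M"
  then have "0 \<le> j $ i \<and> j $ i \<le> int M" "0 \<le> l $ i \<and> l $ i \<le> int M" for i
    by (auto simp: nbox_def)
  then have "\<bar>j $ i - l $ i\<bar> \<le> int M" for i
    by (smt (verit))
  then have "real_of_int \<bar>j $ i - l $ i\<bar> \<le> real M" for i
    by (metis of_int_le_iff of_int_of_nat_eq)
  then show ?thesis by (simp add: int_box_def)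
qed

lemma sum_nbox_prod:
  fixes g :: "'n::finite \<Rightarrow> int \<Rightarrow> 'a::comm_ring_1"
  shows "(\<Sum>j\<in>nbox M. \<Prod>i\<in>UNIV. g i (j $ i)) = (\<Prod>i\<in>UNIV. \<Sum>z\<in>{0..int M}. g i z)"
proof -
  have "(\<Sum>j\<in>nbox M. \<Prod>i\<in>UNIV. g i (j $ i)) = (\<Sum>h\<in>PiE UNIV (\<lambda>_. {0..int M}). \<Prod>i\<in>UNIV. g i (h i))"
    unfolding nbox_def vec_box_eq_image by (subst sum.reindex[OF inj_on_vec_lambda]) simp
  also have "\<dots> = (\<Prod>i\<in>UNIV. \<Sum>z\<in>{0..int M}. g i z)"
    by (rule prod_sum_PiE[symmetric]) auto
  finally show ?thesis .
qed

lemma card_nbox: "card (nbox M :: (int ^ 'n) set) = (M + 1) ^ CARD('n)"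
  unfolding nbox_def by (subst card_vec_box) (auto simp: nat_add_distrib)

lemma tpoly_prod:
  "tpoly (nbox M) (\<lambda>j. \<Prod>i\<in>UNIV. f i (j $ i)) x
    = (\<Prod>i\<in>UNIV. \<Sum>z\<in>{0..int M}. of_real (f i z) * cis (2 * pi * (of_int z * x $ i)))"
proof -
  have cis_sum: "cis (\<Sum>i\<in>A. h i) = (\<Prod>i\<in>A. cis (h i))" if "finite A" for A and h :: "'a \<Rightarrow> real"
    using that by (induction) (auto simp: cis_mult[symmetric])
  have "of_real (\<Prod>i\<in>UNIV. f i (j $ i)) * ech j x
    = (\<Prod>i\<in>UNIV. of_real (f i (j $ i)) * cis (2 * pi * (of_int (j $ i) * x $ i)))" for j
    by (simp add: ech_def sum_distrib_left cis_sum prod.distrib)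
  then show ?thesis
    unfolding tpoly_def by (simp add: sum_nbox_prod[where g="\<lambda>i z. of_real (f i z) * cis (2 * pi * (of_int z * x $ i))"])
qed

text \<open>The diagonal of the double sum has frequency 0 and gives the main term exactly; the rest
  is bounded termwise. The asymmetric treatment of \<open>u\<close> and \<open>v\<close> keeps the
  error linear in the sum of \<open>v\<close>, so that small weights \<open>v\<close> cause a small
  error.\<close>

lemma (in prob_space) expectation_tpoly_mult:
  fixes X :: "'a \<Rightarrow> real ^ 'n" and q :: int
  assumes X: "X \<in> borel_measurable M" and J: "J \<subseteq> nbox N"
    and u: "\<And>j. j \<in> J \<Longrightarrow> \<bar>u j\<bar> \<le> 1" and v: "\<And>j. j \<in> J \<Longrightarrow> v j \<ge> 0"
  shows "norm (expectation (\<lambda>\<omega>. tpoly J u (of_int q *\<^sub>R X \<omega>) * cnj (tpoly J v (of_int q *\<^sub>R X \<omega>)))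
      - of_real (\<Sum>j\<in>J. u j * v j))
    \<le> (\<Sum>j\<in>J. v j) * (\<Sum>m\<in>int_box (real N) - {0}. norm (expectation (\<lambda>\<omega>. ech (q *s m) (X \<omega>))))"
proof -
  have fin: "finite J" using J finite_subset finite_nbox by blast
  define \<Phi> where "\<Phi> \<xi> = expectation (\<lambda>\<omega>. ech \<xi> (X \<omega>))" for \<xi>
  have int: "integrable M (\<lambda>\<omega>. ech \<xi> (X \<omega>))" for \<xi>
    by (rule integrable_const_bound[of _ 1]) (use X in \<open>auto intro: measurable_compose\<close>)
  have "expectation (\<lambda>\<omega>. tpoly J u (of_int q *\<^sub>R X \<omega>) * cnj (tpoly J v (of_int q *\<^sub>R X \<omega>)))
    = expectation (\<lambda>\<omega>. \<Sum>l\<in>J. \<Sum>j\<in>J. of_real (u j * v l) * ech (q *s (j - l)) (X \<omega>))"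
  proof (rule Bochner_Integration.integral_cong[OF refl])
    fix \<omega>
    show "tpoly J u (of_int q *\<^sub>R X \<omega>) * cnj (tpoly J v (of_int q *\<^sub>R X \<omega>))
      = (\<Sum>l\<in>J. \<Sum>j\<in>J. of_real (u j * v l) * ech (q *s (j - l)) (X \<omega>))"
      unfolding tpoly_def ech_scale[symmetric] ech_diff
      by (subst sum.swap) (simp add: sum_product mult_ac)
  qed
  also have "\<dots> = (\<Sum>l\<in>J. \<Sum>j\<in>J. of_real (u j * v l) * \<Phi> (q *s (j - l)))"
    by (simp add: int \<Phi>_def del: of_real_mult)
  also have "\<dots> = (\<Sum>l\<in>J. of_real (u l * v l)
      + (\<Sum>j\<in>J-{l}. of_real (u j * v l) * \<Phi> (q *s (j - l))))"
  proof (rule sum.cong[OF refl])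
    fix l assume "l \<in> J"
    have "q *s (l - l) = (0 :: int ^ 'n)" by (simp add: vec_eq_iff)
    then show "(\<Sum>j\<in>J. of_real (u j * v l) * \<Phi> (q *s (j - l))) = of_real (u l * v l)
      + (\<Sum>j\<in>J-{l}. of_real (u j * v l) * \<Phi> (q *s (j - l)))"
      by (subst sum.remove[OF fin \<open>l \<in> J\<close>]) (simp add: \<Phi>_def prob_space)
  qed
  finally have "expectation (\<lambda>\<omega>. tpoly J u (of_int q *\<^sub>R X \<omega>) * cnj (tpoly J v (of_int q *\<^sub>R X \<omega>)))
      - of_real (\<Sum>j\<in>J. u j * v j)
    = (\<Sum>l\<in>J. \<Sum>j\<in>J-{l}. of_real (u j * v l) * \<Phi> (q *s (j - l)))"
    by (simp add: sum.distrib)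
  also have "norm \<dots> \<le> (\<Sum>l\<in>J. v l * (\<Sum>m\<in>int_box (real N) - {0}. norm (\<Phi> (q *s m))))"
  proof (rule sum_norm_le)
    fix l assume l: "l \<in> J"
    have "norm (\<Sum>j\<in>J-{l}. of_real (u j * v l) * \<Phi> (q *s (j - l)))
      \<le> (\<Sum>j\<in>J-{l}. v l * norm (\<Phi> (q *s (j - l))))"
    proof (rule sum_norm_le)
      fix j assume "j \<in> J - {l}"
      then have "\<bar>u j\<bar> * (v l * norm (\<Phi> (q *s (j - l)))) \<le> 1 * (v l * norm (\<Phi> (q *s (j - l))))"
        using u v l by (intro mult_right_mono) auto
      then show "norm (of_real (u j * v l) * \<Phi> (q *s (j - l))) \<le> v l * norm (\<Phi> (q *s (j - l)))"
        using v[OF l] by (simp add: norm_mult abs_mult mult_ac)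
    qed
    \<comment> \<open>For fixed l the map from j to j - l is injective, so each nonzero frequency is
      used at most once.\<close>
    also have "\<dots> = v l * (\<Sum>m\<in>(\<lambda>j. j - l) ` (J - {l}). norm (\<Phi> (q *s m)))"
      by (subst sum.reindex) (auto simp: inj_on_def sum_distrib_left)
    also have "\<dots> \<le> v l * (\<Sum>m\<in>int_box (real N) - {0}. norm (\<Phi> (q *s m)))"
    proof (intro mult_left_mono sum_mono2)
      show "(\<lambda>j. j - l) ` (J - {l}) \<subseteq> int_box (real N) - {0}"
        using J l nbox_diff_in_int_box[of _ N l] by fastforce
    qed (use v[OF l] in auto)
    finally show "norm (\<Sum>j\<in>J-{l}. of_real (u j * v l) * \<Phi> (q *s (j - l)))
      \<le> v l * (\<Sum>m\<in>int_box (real N) - {0}. norm (\<Phi> (q *s m)))" .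
  qed
  finally show ?thesis by (simp add: \<Phi>_def sum_distrib_right)
qed

lemma tpoly_bound: "\<forall>j\<in>J. \<bar>u j\<bar> \<le> B j \<Longrightarrow> norm (tpoly J u x) \<le> (\<Sum>j\<in>J. B j)"
  unfolding tpoly_def by (rule sum_norm_le) (simp add: norm_mult)

lemma (in prob_space) integrable_tpoly_mult:
  fixes X :: "'a \<Rightarrow> real ^ 'n" and q :: int
  assumes X[measurable]: "X \<in> borel_measurable M"
  shows "integrable M (\<lambda>\<omega>. tpoly J u (of_int q *\<^sub>R X \<omega>) * cnj (tpoly J v (of_int q *\<^sub>R X \<omega>)))"
proof (rule integrable_const_bound[of _ "(\<Sum>j\<in>J. \<bar>u j\<bar>) * (\<Sum>j\<in>J. \<bar>v j\<bar>)"])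
  show "AE \<omega> in M. norm (tpoly J u (of_int q *\<^sub>R X \<omega>) * cnj (tpoly J v (of_int q *\<^sub>R X \<omega>)))
    \<le> (\<Sum>j\<in>J. \<bar>u j\<bar>) * (\<Sum>j\<in>J. \<bar>v j\<bar>)"
    by (intro AE_I2) (auto simp: norm_mult intro!: mult_mono tpoly_bound sum_nonneg)
  have cnj: "cnj \<in> borel_measurable borel"
    by (intro borel_measurable_continuous_onI continuous_intros)
  show "(\<lambda>\<omega>. tpoly J u (of_int q *\<^sub>R X \<omega>) * cnj (tpoly J v (of_int q *\<^sub>R X \<omega>))) \<in> borel_measurable M"
    by (intro borel_measurable_times measurable_compose[OF _ cnj] measurable_compose[OF _ tpoly_measurable]) measurable
qed

section \<open>Majorant and minorant kernels\<close>

text \<open>Near an integer point all phases stay within \<pi>/4 of 0 after an integer translation,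
  so every term has real part at least \<surd>2/2 and nothing cancels.\<close>

lemma norm_tpoly_ge:
  fixes x :: "real ^ 'n"
  assumes a: "\<And>i. \<bar>x $ i - real_of_int (a $ i)\<bar> \<le> \<rho>" and \<rho>: "real CARD('n) * real N * \<rho> \<le> 1 / 8"
  shows "(real (N + 1) ^ CARD('n))\<^sup>2 / 2 \<le> (norm (tpoly (nbox N) (\<lambda>_. 1) x))\<^sup>2"
proof -
  define t where "t = x - (\<chi> i. real_of_int (a $ i))"
  have t: "\<bar>t $ i\<bar> \<le> \<rho>" for i using a by (simp add: t_def)
  have re: "sqrt 2 / 2 \<le> Re (ech j x)" if j: "j \<in> nbox N" for j
  proof -
    have "\<bar>\<Sum>i\<in>UNIV. real_of_int (j $ i) * t $ i\<bar> \<le> (\<Sum>i\<in>(UNIV::'n set). real N * \<rho>)"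
    proof (rule order_trans[OF sum_abs], rule sum_mono)
      fix i
      have "0 \<le> j $ i" "j $ i \<le> int N" using j by (auto simp: nbox_def)
      then have "\<bar>real_of_int (j $ i)\<bar> \<le> real N" by linarith
      then show "\<bar>real_of_int (j $ i) * t $ i\<bar> \<le> real N * \<rho>"
        using t[of i] by (simp add: abs_mult mult_mono)
    qed
    also have "\<dots> \<le> 1 / 8" using \<rho> by simp
    finally have "\<bar>2 * pi * (\<Sum>i\<in>UNIV. real_of_int (j $ i) * t $ i)\<bar> \<le> 2 * pi * (1 / 8)"
      unfolding abs_mult by (intro mult_mono) auto
    then have le: "\<bar>2 * pi * (\<Sum>i\<in>UNIV. real_of_int (j $ i) * t $ i)\<bar> \<le> pi / 4" by simp
    have "sqrt 2 / 2 = cos (pi / 4)" by (simp add: cos_45)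
    also have "\<dots> \<le> cos \<bar>2 * pi * (\<Sum>i\<in>UNIV. real_of_int (j $ i) * t $ i)\<bar>"
      using le pi_gt_zero by (intro cos_monotone_0_pi_le) auto
    also have "\<dots> = Re (ech j t)" by (simp only: ech_def cos_abs_real cis.sel)
    also have "\<dots> = Re (ech j x)" by (simp add: t_def ech_diff_int)
    finally show ?thesis .
  qed
  have "real (N + 1) ^ CARD('n) * (sqrt 2 / 2) = (\<Sum>j\<in>(nbox N::(int^'n) set). sqrt 2 / 2)"
    by (simp add: card_nbox)
  also have "\<dots> \<le> (\<Sum>j\<in>nbox N. Re (ech j x))" by (intro sum_mono re)
  also have "\<dots> = Re (tpoly (nbox N) (\<lambda>_. 1) x)" by (simp add: tpoly_def)
  also have "\<dots> \<le> norm (tpoly (nbox N) (\<lambda>_. 1) x)" by (rule complex_Re_le_cmod)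
  finally have "(real (N + 1) ^ CARD('n) * (sqrt 2 / 2))\<^sup>2 \<le> (norm (tpoly (nbox N) (\<lambda>_. 1) x))\<^sup>2"
    by (intro power_mono) auto
  then show ?thesis by (simp add: power_mult_distrib power_divide)
qed

lemma norm_sq_eq_Re_mult_cnj: "(norm z)\<^sup>2 = Re (z * cnj z)"
  by (metis complex_norm_square Re_complex_of_real)

text \<open>With all weights 1 the diagonal has (N + 1)^k terms, while the peak value is the square
  of that number; the normalised majorant therefore has mean of order N^(-k).\<close>

lemma (in prob_space) expectation_norm_tpoly_le:
  fixes X :: "'a \<Rightarrow> real ^ 'n" and q :: int
  assumes X: "X \<in> borel_measurable M"
  shows "expectation (\<lambda>\<omega>. (norm (tpoly (nbox N) (\<lambda>_. 1) (of_int q *\<^sub>R X \<omega>)))\<^sup>2)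
    \<le> real (N + 1) ^ CARD('n) * (1 + (\<Sum>m\<in>int_box (real N) - {0}. norm (expectation (\<lambda>\<omega>. ech (q *s m) (X \<omega>)))))"
proof -
  let ?E = "\<Sum>m\<in>int_box (real N) - {0}. norm (expectation (\<lambda>\<omega>. ech (q *s m) (X \<omega>)))"
  let ?I = "expectation (\<lambda>\<omega>. tpoly (nbox N) (\<lambda>_. 1) (of_int q *\<^sub>R X \<omega>) * cnj (tpoly (nbox N) (\<lambda>_. 1) (of_int q *\<^sub>R X \<omega>)))"
  have "norm (?I - of_real (\<Sum>j\<in>(nbox N::(int^'n) set). 1 * 1)) \<le> (\<Sum>j\<in>(nbox N::(int^'n) set). 1) * ?E"
    by (rule expectation_tpoly_mult[OF X]) auto
  then have "norm (?I - of_real (real (N + 1) ^ CARD('n))) \<le> real (N + 1) ^ CARD('n) * ?E"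
    by (simp add: card_nbox del: of_real_power)
  then have "Re (?I - of_real (real (N + 1) ^ CARD('n))) \<le> real (N + 1) ^ CARD('n) * ?E"
    using complex_Re_le_cmod order_trans by blast
  then have "Re ?I \<le> real (N + 1) ^ CARD('n) * (1 + ?E)"
    by (simp add: distrib_left del: of_real_power of_real_add of_nat_add)
  then show ?thesis
    unfolding norm_sq_eq_Re_mult_cnj using integral_Re[OF integrable_tpoly_mult[OF X]] by metis
qed

text \<open>
  The sequence \<open>sin (\<pi> z / N)\<close> on \<open>0, \<dots>, N\<close> is an eigenvector of the discrete Laplacian with Dirichlet
  boundary conditions, so multiplying its generating polynomial by \<open>cos (2 \<pi> t)\<close> scales it and adds
  only two edge terms of size \<open>O(1 / N)\<close>.
\<close>

definition sin_wt :: "nat \<Rightarrow> int \<Rightarrow> real" where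
  "sin_wt N z = sin (pi * of_int z / real N)"

definition edge_wt :: "nat \<Rightarrow> int \<Rightarrow> real" where
  "edge_wt N z = sin (pi / real N) / 2 * (of_bool (z = 0) + of_bool (z = int N))"

text \<open>Summation by parts: moving the two-sided shift from \<open>e\<close> to \<open>s\<close>
  leaves boundary terms that involve both sequences one step outside the range.\<close>

lemma sum_shift_telescope:
  fixes s e :: "int \<Rightarrow> complex"
  shows "(\<Sum>z\<in>{0..int N}. s z * (e (z + 1) + e (z - 1)))
    = (\<Sum>z\<in>{0..int N}. (s (z - 1) + s (z + 1)) * e z)
      + (s (int N) * e (int N + 1) - s (int N + 1) * e (int N)) - (s (-1) * e 0 - s 0 * e (-1))"
proof (induction N)
  case (Suc N)
  have "{0..int (Suc N)} = insert (int N + 1) {0..int N}" by auto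
  then have *: "sum f {0..int (Suc N)} = f (int N + 1) + sum f {0..int N}" for f :: "int \<Rightarrow> complex" by simp
  show ?case unfolding * Suc.IH by (simp add: algebra_simps)
qed (simp add: algebra_simps)

lemma cos_mult_sin_kernel:
  assumes "N > 0"
  shows "of_real (cos (2 * pi * t)) * (\<Sum>z\<in>{0..int N}. of_real (sin_wt N z) * cis (2 * pi * (of_int z * t)))
    = of_real (cos (pi / real N)) * (\<Sum>z\<in>{0..int N}. of_real (sin_wt N z) * cis (2 * pi * (of_int z * t)))
      + (\<Sum>z\<in>{0..int N}. of_real (edge_wt N z) * cis (2 * pi * (of_int z * t)))"
proof -
  define s where "s z = complex_of_real (sin_wt N z)" for z
  define e where "e z = cis (2 * pi * (of_int z * t))" for z :: int
  have cis2: "2 * of_real (cos \<theta>) = cis \<theta> + cis (- \<theta>)" for \<theta>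
    by (simp add: complex_eq_iff)
  have e1: "2 * of_real (cos (2 * pi * t)) * e z = e (z + 1) + e (z - 1)" for z
    unfolding cis2 by (simp add: e_def distrib_right cis_mult algebra_simps)
  have s1: "s (z - 1) + s (z + 1) = 2 * of_real (cos (pi / real N)) * s z" for z
  proof -
    have "sin_wt N (z - 1) + sin_wt N (z + 1) = 2 * cos (pi / real N) * sin_wt N z"
      by (simp add: sin_wt_def diff_divide_distrib add_divide_distrib distrib_left right_diff_distrib
          sin_add sin_diff)
    then show ?thesis unfolding s_def by (metis of_real_add of_real_mult of_real_numeral)
  qed
  \<comment> \<open>The sine vanishes at 0 and N, which removes the exponentials outside the range;
    its values at -1 and N + 1 do not vanish in general and produce the two edge terms.\<close>
  have sm1: "s (-1) = - of_real (sin (pi / real N))" by (simp add: s_def sin_wt_def)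
  have s0: "s 0 = 0" by (simp add: s_def sin_wt_def)
  have sN: "s (int N) = 0" using assms by (simp add: s_def sin_wt_def)
  have sN1: "s (int N + 1) = - of_real (sin (pi / real N))"
    using assms by (simp add: s_def sin_wt_def distrib_left add_divide_distrib sin_add)
  have e0: "e 0 = 1" by (simp add: e_def)
  have edge: "2 * (\<Sum>z\<in>{0..int N}. of_real (edge_wt N z) * e z) = of_real (sin (pi / real N)) * (1 + e (int N))"
  proof -
    have "(\<Sum>z\<in>{0..int N}. of_real (edge_wt N z) * e z)
      = (\<Sum>z\<in>{0, int N}. of_real (edge_wt N z) * e z)"
      by (rule sum.mono_neutral_right) (auto simp: edge_wt_def)
    then show ?thesis using assms by (simp add: edge_wt_def e0 algebra_simps)
  qed
  have "2 * of_real (cos (2 * pi * t)) * (\<Sum>z\<in>{0..int N}. s z * e z)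
    = (\<Sum>z\<in>{0..int N}. s z * (e (z + 1) + e (z - 1)))"
    by (simp add: sum_distrib_left e1[symmetric] mult_ac)
  also have "\<dots> = (\<Sum>z\<in>{0..int N}. 2 * of_real (cos (pi / real N)) * s z * e z)
      + of_real (sin (pi / real N)) * (1 + e (int N))"
    unfolding sum_shift_telescope s1 sm1 s0 sN sN1 e0 by (simp add: algebra_simps)
  also have "\<dots> = 2 * (of_real (cos (pi / real N)) * (\<Sum>z\<in>{0..int N}. s z * e z)
      + (\<Sum>z\<in>{0..int N}. of_real (edge_wt N z) * e z))"
    unfolding distrib_left edge by (simp add: sum_distrib_left mult.assoc)
  finally have "2 * (of_real (cos (2 * pi * t)) * (\<Sum>z\<in>{0..int N}. s z * e z))
    = 2 * (of_real (cos (pi / real N)) * (\<Sum>z\<in>{0..int N}. s z * e z)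
      + (\<Sum>z\<in>{0..int N}. of_real (edge_wt N z) * e z))"
    by (simp only: mult.assoc)
  then show ?thesis unfolding s_def e_def mult_cancel_left by simp
qed

definition sin_poly :: "nat \<Rightarrow> real ^ 'n \<Rightarrow> complex" where
  "sin_poly N = tpoly (nbox N) (\<lambda>j. \<Prod>i\<in>UNIV. sin_wt N (j $ i))"

definition edge_poly :: "nat \<Rightarrow> 'n \<Rightarrow> real ^ 'n \<Rightarrow> complex" where
  "edge_poly N i = tpoly (nbox N) (\<lambda>j. \<Prod>l\<in>UNIV. (if l = i then edge_wt N else sin_wt N) (j $ l))"

text \<open>
  The first factor is positive only if every coordinate of \<open>x\<close> is within \<open>\<rho>\<close> of an integer. It is
  then \<open>O(\<rho>\<^sup>2)\<close>, which the main term and the error term of the average both have to match; this is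
  why the kernel must have second moment \<open>O(1 / N\<^sup>2)\<close> and Fejer's kernel would not do.
\<close>

definition minorant :: "nat \<Rightarrow> real \<Rightarrow> real ^ 'n \<Rightarrow> real" where
  "minorant N \<rho> x = ((\<Sum>i\<in>UNIV. cos (2 * pi * x $ i)) - (real CARD('n) - 1) - cos (2 * pi * \<rho>))
      * (norm (sin_poly N x))\<^sup>2"

text \<open>The polynomial is a product over coordinates and the cosine meets only its factor i, so
  the one-dimensional identity applies and the other factors are common to all terms.\<close>

lemma cos_mult_sin_poly:
  fixes x :: "real ^ 'n"
  assumes "N > 0"
  shows "of_real (cos (2 * pi * x $ i)) * sin_poly N x = of_real (cos (pi / real N)) * sin_poly N x + edge_poly N i x"
proof -
  let ?S = "\<lambda>w l. \<Sum>z\<in>{0..int N}. of_real (w z) * cis (2 * pi * (of_int z * x $ l))"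
  have W: "sin_poly N x = ?S (sin_wt N) i * (\<Prod>l\<in>UNIV-{i}. ?S (sin_wt N) l)"
    unfolding sin_poly_def tpoly_prod[where f = "\<lambda>_. sin_wt N"] by (rule prod.remove) auto
  have "edge_poly N i x = ?S (edge_wt N) i * (\<Prod>l\<in>UNIV-{i}. ?S (if l = i then edge_wt N else sin_wt N) l)"
    unfolding edge_poly_def tpoly_prod[where f = "\<lambda>l. if l = i then edge_wt N else sin_wt N"]
    by (subst prod.remove[of _ i]) auto
  also have "(\<Prod>l\<in>UNIV-{i}. ?S (if l = i then edge_wt N else sin_wt N) l) = (\<Prod>l\<in>UNIV-{i}. ?S (sin_wt N) l)"
    by (intro prod.cong) auto
  finally have V: "edge_poly N i x = ?S (edge_wt N) i * (\<Prod>l\<in>UNIV-{i}. ?S (sin_wt N) l)" .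
  show ?thesis unfolding W V using cos_mult_sin_kernel[OF assms, of "x $ i"]
    by (simp only: mult.assoc[symmetric] distrib_right[symmetric])
qed

text \<open>\<open>sin_poly\<close> is an approximate eigenvector of multiplication by each of the k
  cosines. Applying this to one of the two copies of \<open>sin_poly\<close> replaces the
  sign-changing factor by a constant, at the price of cross terms with
  \<open>edge_poly\<close>.\<close>

lemma minorant_eq:
  fixes x :: "real ^ 'n"
  assumes "N > 0"
  shows "minorant N \<rho> x = (1 - cos (2 * pi * \<rho>) - real CARD('n) * (1 - cos (pi / real N))) * Re (sin_poly N x * cnj (sin_poly N x))
    + (\<Sum>i\<in>UNIV. Re (sin_poly N x * cnj (edge_poly N i x)))"
proof -
  define R where "R = Re (sin_poly N x * cnj (sin_poly N x))"
  define T where "T i = Re (sin_poly N x * cnj (edge_poly N i x))" for i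
  have "cos (2 * pi * x $ i) * R = cos (pi / real N) * R + T i" for i
  proof -
    have "of_real (cos (2 * pi * x $ i)) * (sin_poly N x * cnj (sin_poly N x))
      = sin_poly N x * cnj (of_real (cos (2 * pi * x $ i)) * sin_poly N x)" by simp
    also have "\<dots> = of_real (cos (pi / real N)) * (sin_poly N x * cnj (sin_poly N x)) + sin_poly N x * cnj (edge_poly N i x)"
      unfolding cos_mult_sin_poly[OF assms] by (simp add: algebra_simps)
    finally have "Re (of_real (cos (2 * pi * x $ i)) * (sin_poly N x * cnj (sin_poly N x)))
      = Re (of_real (cos (pi / real N)) * (sin_poly N x * cnj (sin_poly N x)) + sin_poly N x * cnj (edge_poly N i x))"
      by (rule arg_cong)
    moreover have "Re (of_real c * z) = c * Re z" for c z by simp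
    ultimately show ?thesis by (simp only: plus_complex.sel R_def T_def)
  qed
  then have "(\<Sum>i\<in>UNIV. cos (2 * pi * x $ i) * R) = (\<Sum>i\<in>(UNIV::'n set). cos (pi / real N) * R + T i)"
    by (intro sum.cong) auto
  then have "(\<Sum>i\<in>UNIV. cos (2 * pi * x $ i)) * R = real CARD('n) * cos (pi / real N) * R + (\<Sum>i\<in>UNIV. T i)"
    by (simp add: sum.distrib sum_distrib_right)
  then show ?thesis unfolding minorant_def norm_sq_eq_Re_mult_cnj R_def[symmetric] T_def[symmetric]
    by (simp add: algebra_simps)
qed

lemma abs_prod_sin_wt_le: "\<bar>\<Prod>i\<in>I. sin_wt N (j i)\<bar> \<le> 1"
  unfolding abs_prod by (rule prod_le_1) (auto simp: sin_wt_def)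

text \<open>If one coordinate is farther than \<rho> from the integers, its cosine is at most cos(2
  \<pi> \<rho>) and the other cosines are at most 1, so the first factor is nonpositive.\<close>

lemma minorant_le:
  fixes x :: "real ^ 'n"
  assumes \<rho>: "0 < \<rho>" "\<rho> \<le> 1 / 2"
  shows "minorant N \<rho> x \<le> (if \<exists>a::int^'n. \<forall>i. \<bar>x $ i - real_of_int (a $ i)\<bar> \<le> \<rho>
      then (1 - cos (2 * pi * \<rho>)) * (real (N + 1) ^ CARD('n))\<^sup>2 else 0)"
proof -
  let ?\<beta> = "(\<Sum>i\<in>UNIV. cos (2 * pi * x $ i)) - (real CARD('n) - 1) - cos (2 * pi * \<rho>)"
  have "norm (sin_poly N x) \<le> (\<Sum>j\<in>(nbox N::(int^'n) set). 1)"
    unfolding sin_poly_def by (rule tpoly_bound) (auto intro: abs_prod_sin_wt_le)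
  then have W: "(norm (sin_poly N x))\<^sup>2 \<le> (real (N + 1) ^ CARD('n))\<^sup>2"
    by (intro power_mono) (auto simp: card_nbox)
  have "(\<Sum>i\<in>UNIV. cos (2 * pi * x $ i)) \<le> (\<Sum>i\<in>(UNIV::'n set). 1)" by (intro sum_mono) auto
  then have \<beta>1: "?\<beta> \<le> 1 - cos (2 * pi * \<rho>)" by simp
  show ?thesis
  proof (cases "?\<beta> \<le> 0")
    case True
    then have "minorant N \<rho> x \<le> 0" unfolding minorant_def by (simp add: mult_nonpos_nonneg)
    then show ?thesis by (auto intro: order_trans)
  next
    case False
    have "\<bar>x $ i - real_of_int ((\<chi> i. round (x $ i)) $ i)\<bar> \<le> \<rho>" for i
    proof (rule ccontr)
      assume "\<not> ?thesis"
      then have gt: "\<rho> < \<bar>x $ i - real_of_int (round (x $ i))\<bar>" by simp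
      have half: "\<bar>x $ i - real_of_int (round (x $ i))\<bar> \<le> 1 / 2"
        using of_int_round_abs_le[of "x $ i"] by (simp add: abs_minus_commute)
      \<comment> \<open>By evenness and periodicity the cosine sees only the distance to the nearest
        integer, which is at most 1/2 and so lies in the range where the cosine decreases.\<close>
      have "cos (2 * pi * x $ i) = cos (2 * pi * \<bar>x $ i - real_of_int (round (x $ i))\<bar>)"
      proof -
        have "cos (2 * pi * \<bar>x $ i - real_of_int (round (x $ i))\<bar>) = cos \<bar>2 * pi * (x $ i - real_of_int (round (x $ i)))\<bar>"
          by (simp add: abs_mult)
        also have "\<dots> = cos (2 * pi * x $ i - 2 * pi * real_of_int (round (x $ i)))"
          by (simp only: cos_abs_real right_diff_distrib)
        also have "\<dots> = cos (2 * pi * x $ i)"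
          using cos_int_2pin sin_int_2pin by (simp add: cos_diff)
        finally show ?thesis by simp
      qed
      also have "\<dots> \<le> cos (2 * pi * \<rho>)"
        using gt half \<rho> by (intro cos_monotone_0_pi_le) (auto simp: field_simps)
      finally have le: "cos (2 * pi * x $ i) \<le> cos (2 * pi * \<rho>)" .
      have "(\<Sum>l\<in>UNIV. cos (2 * pi * x $ l)) = cos (2 * pi * x $ i) + (\<Sum>l\<in>UNIV-{i}. cos (2 * pi * x $ l))"
        by (rule sum.remove) auto
      also have "\<dots> \<le> cos (2 * pi * x $ i) + (\<Sum>l\<in>UNIV-{i}. 1)"
        by (intro add_left_mono sum_mono) auto
      finally have "(\<Sum>l\<in>UNIV. cos (2 * pi * x $ l)) \<le> cos (2 * pi * x $ i) + (real CARD('n) - 1)"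
        by (simp add: card_Diff_singleton of_nat_diff)
      with le False show False by linarith
    qed
    then have ex: "\<exists>a::int^'n. \<forall>i. \<bar>x $ i - real_of_int (a $ i)\<bar> \<le> \<rho>" by blast
    have "minorant N \<rho> x \<le> (1 - cos (2 * pi * \<rho>)) * (real (N + 1) ^ CARD('n))\<^sup>2"
      unfolding minorant_def using \<beta>1 W False by (intro mult_mono) auto
    then show ?thesis using ex by simp
  qed
qed

text \<open>Shifting by half the period turns the sine into a cosine, so the two halves pair up to L
  ones; the last term vanishes because sin \<pi> = 0. This is why the degree is taken even.\<close>

lemma sum_sin_wt_sq:
  assumes "L > 0"
  shows "(\<Sum>z\<in>{0..int (2 * L)}. (sin_wt (2 * L) z)\<^sup>2) = real L"
proof -
  have "(\<Sum>z\<in>{0..int (2 * L)}. (sin_wt (2 * L) z)\<^sup>2) = (\<Sum>z\<in>{0..<int L} \<union> {int L..<int (2 * L)}. (sin_wt (2 * L) z)\<^sup>2)"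
    using assms by (intro sum.mono_neutral_right) (auto simp: sin_wt_def not_less dest!: antisym)
  also have "\<dots> = (\<Sum>z\<in>{0..<int L}. (sin_wt (2 * L) z)\<^sup>2) + (\<Sum>z\<in>{int L..<int (2 * L)}. (sin_wt (2 * L) z)\<^sup>2)"
    by (rule sum.union_disjoint) auto
  also have "(\<Sum>z\<in>{int L..<int (2 * L)}. (sin_wt (2 * L) z)\<^sup>2) = (\<Sum>z\<in>{0..<int L}. (sin_wt (2 * L) (z + int L))\<^sup>2)"
    by (rule sum.reindex_bij_witness[of _ "\<lambda>z. z + int L" "\<lambda>z. z - int L"]) auto
  also have "\<dots> = (\<Sum>z\<in>{0..<int L}. (cos (pi * of_int z / real (2 * L)))\<^sup>2)"
  proof (intro sum.cong refl)
    fix z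
    have "sin_wt (2 * L) (z + int L) = sin (pi * of_int z / real (2 * L) + pi / 2)"
      using assms by (simp add: sin_wt_def field_simps)
    then show "(sin_wt (2 * L) (z + int L))\<^sup>2 = (cos (pi * of_int z / real (2 * L)))\<^sup>2"
      by (simp add: sin_add)
  qed
  finally show ?thesis
    by (simp add: sum.distrib[symmetric] sin_wt_def)
qed

lemma sin_wt_nonneg: "z \<in> {0..int N} \<Longrightarrow> sin_wt N z \<ge> 0"
  unfolding sin_wt_def by (rule sin_ge_zero) (auto simp: divide_le_eq mult_left_mono)

lemma edge_wt_nonneg: "N > 0 \<Longrightarrow> edge_wt N z \<ge> 0"
  unfolding edge_wt_def by (intro mult_nonneg_nonneg divide_nonneg_nonneg sin_ge_zero) (auto simp: divide_le_eq)

lemma sum_sin_wt_le: "(\<Sum>z\<in>{0..int N}. sin_wt N z) \<le> real (N + 1)"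
proof -
  have "(\<Sum>z\<in>{0..int N}. sin_wt N z) \<le> (\<Sum>z\<in>{0..int N}. 1)" by (intro sum_mono) (auto simp: sin_wt_def)
  then show ?thesis by (simp add: nat_add_distrib)
qed

lemma sum_edge_wt: "N > 0 \<Longrightarrow> (\<Sum>z\<in>{0..int N}. edge_wt N z) = sin (pi / real N)"
proof -
  assume "N > 0"
  have "(\<Sum>z\<in>{0..int N}. edge_wt N z) = (\<Sum>z\<in>{0, int N}. edge_wt N z)"
    by (rule sum.mono_neutral_right) (auto simp: edge_wt_def)
  then show ?thesis using \<open>N > 0\<close> by (simp add: edge_wt_def)
qed

lemma (in prob_space) integrable_minorant:
  fixes X :: "'a \<Rightarrow> real ^ 'n" and q :: int
  assumes X: "X \<in> borel_measurable M" and "N > 0"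
  shows "integrable M (\<lambda>\<omega>. minorant N \<rho> (of_int q *\<^sub>R X \<omega>))"
  unfolding minorant_eq[OF assms(2)] unfolding sin_poly_def edge_poly_def
  by (intro Bochner_Integration.integrable_add Bochner_Integration.integrable_sum integrable_mult_right
      integrable_Re integrable_tpoly_mult X)

text \<open>The main term is \<open>lam\<close> times the diagonal sum of squared sines. Each of the
  k edge polynomials adds an error whose weights have total at most \<pi> / N^2 relative to (N +
  1)^k, the size that can be compared with \<open>lam\<close>.\<close>

lemma (in prob_space) expectation_minorant_ge:
  fixes X :: "'a \<Rightarrow> real ^ 'n" and q :: int
  assumes X: "X \<in> borel_measurable M" and N: "N = 2 * L" and L: "L > 0"
    and lam: "lam = 1 - cos (2 * pi * \<rho>) - real CARD('n) * (1 - cos (pi / real N))" and lam0: "lam \<ge> 0"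
  shows "expectation (\<lambda>\<omega>. minorant N \<rho> (of_int q *\<^sub>R X \<omega>))
    \<ge> lam * real L ^ CARD('n) - (lam + real CARD('n) * pi / (real N)\<^sup>2) * real (N + 1) ^ CARD('n)
      * (\<Sum>m\<in>int_box (real N) - {0}. norm (expectation (\<lambda>\<omega>. ech (q *s m) (X \<omega>))))"
proof -
  let ?E = "\<Sum>m\<in>int_box (real N) - {0}. norm (expectation (\<lambda>\<omega>. ech (q *s m) (X \<omega>)))"
  let ?k = "CARD('n)"
  have N0: "N > 0" using N L by simp
  have E0: "?E \<ge> 0" by (intro sum_nonneg) auto
  define w where "w j = (\<Prod>i\<in>UNIV. sin_wt N (j $ i))" for j :: "int ^ 'n"
  define v where "v i j = (\<Prod>l\<in>UNIV. (if l = i then edge_wt N else sin_wt N) (j $ l))" for i and j :: "int ^ 'n"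
  have w0: "w j \<ge> 0" if "j \<in> nbox N" for j
    unfolding w_def using that by (intro prod_nonneg) (auto simp: nbox_def intro!: sin_wt_nonneg)
  have v0: "v i j \<ge> 0" if "j \<in> nbox N" for i j
    unfolding v_def using that N0 by (intro prod_nonneg) (auto simp: nbox_def intro!: sin_wt_nonneg edge_wt_nonneg)
  have w1: "\<bar>w j\<bar> \<le> 1" for j unfolding w_def by (rule abs_prod_sin_wt_le)
  have sw: "(\<Sum>j\<in>nbox N. w j) \<le> real (N + 1) ^ ?k"
  proof -
    have "(\<Sum>j\<in>nbox N. w j) = (\<Sum>z\<in>{0..int N}. sin_wt N z) ^ ?k"
      unfolding w_def by (subst sum_nbox_prod[where g = "\<lambda>_. sin_wt N"]) simp
    also have "\<dots> \<le> real (N + 1) ^ ?k"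
      by (intro power_mono sum_sin_wt_le sum_nonneg sin_wt_nonneg)
    finally show ?thesis .
  qed
  have sww: "(\<Sum>j\<in>nbox N. w j * w j) = real L ^ ?k"
  proof -
    have "(\<Sum>j\<in>nbox N. w j * w j) = (\<Sum>j\<in>nbox N. \<Prod>i\<in>(UNIV::'n set). (sin_wt N (j $ i))\<^sup>2)"
      unfolding w_def by (simp add: prod.distrib power2_eq_square)
    also have "\<dots> = (\<Sum>z\<in>{0..int N}. (sin_wt N z)\<^sup>2) ^ ?k"
      by (subst sum_nbox_prod[where g = "\<lambda>i z. (sin_wt N z)\<^sup>2"]) simp
    finally show ?thesis using sum_sin_wt_sq[OF L] by (simp add: N)
  qed
  have sv: "(\<Sum>j\<in>nbox N. v i j) \<le> pi / (real N)\<^sup>2 * real (N + 1) ^ ?k" for i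
  proof -
    have "(\<Sum>j\<in>nbox N. v i j) = (\<Prod>l\<in>UNIV. \<Sum>z\<in>{0..int N}. (if l = i then edge_wt N else sin_wt N) z)"
      unfolding v_def by (rule sum_nbox_prod[where g = "\<lambda>l. if l = i then edge_wt N else sin_wt N"])
    also have "\<dots> = (\<Sum>z\<in>{0..int N}. edge_wt N z) * (\<Prod>l\<in>UNIV-{i}. \<Sum>z\<in>{0..int N}. (if l = i then edge_wt N else sin_wt N) z)"
      by (subst prod.remove[of _ i]) auto
    also have "(\<Prod>l\<in>UNIV-{i}. \<Sum>z\<in>{0..int N}. (if l = i then edge_wt N else sin_wt N) z)
      = (\<Prod>l\<in>UNIV-{i}. \<Sum>z\<in>{0..int N}. sin_wt N z)" by (intro prod.cong) auto
    also have "\<dots> = (\<Sum>z\<in>{0..int N}. sin_wt N z) ^ (?k - 1)" by (simp add: card_Diff_singleton)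
    also have "(\<Sum>z\<in>{0..int N}. edge_wt N z) * \<dots> \<le> pi / real N * real (N + 1) ^ (?k - 1)"
    proof (rule mult_mono)
      show "(\<Sum>z\<in>{0..int N}. edge_wt N z) \<le> pi / real N"
        unfolding sum_edge_wt[OF N0] by (rule sin_x_le_x) simp
      show "(\<Sum>z\<in>{0..int N}. sin_wt N z) ^ (?k - 1) \<le> real (N + 1) ^ (?k - 1)"
        by (intro power_mono sum_sin_wt_le sum_nonneg sin_wt_nonneg)
    qed (auto intro!: zero_le_power sum_nonneg sin_wt_nonneg)
    \<comment> \<open>One factor 1 / N comes from the size of the edge weight, a second one from
      coordinate i having two nonzero weights instead of N + 1.\<close>
    also have "\<dots> = pi / real N * (real (N + 1) ^ ?k / real (N + 1))"
      by (simp add: power_diff)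
    also have "\<dots> \<le> pi / real N * (real (N + 1) ^ ?k / real N)"
      using N0 by (intro mult_left_mono divide_left_mono) auto
    finally show ?thesis by (simp add: power2_eq_square)
  qed
  let ?I = "\<lambda>u. expectation (\<lambda>\<omega>. tpoly (nbox N) w (of_int q *\<^sub>R X \<omega>) * cnj (tpoly (nbox N) u (of_int q *\<^sub>R X \<omega>)))"
  have Re_ge: "Re (?I u) \<ge> (\<Sum>j\<in>nbox N. w j * u j) - (\<Sum>j\<in>nbox N. u j) * ?E"
    if "\<And>j. j \<in> nbox N \<Longrightarrow> u j \<ge> 0" for u
  proof -
    have "norm (?I u - of_real (\<Sum>j\<in>nbox N. w j * u j)) \<le> (\<Sum>j\<in>nbox N. u j) * ?E"
      using that w1 by (intro expectation_tpoly_mult[OF X]) auto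
    then have "\<bar>Re (?I u - of_real (\<Sum>j\<in>nbox N. w j * u j))\<bar> \<le> (\<Sum>j\<in>nbox N. u j) * ?E"
      using abs_Re_le_cmod order_trans by blast
    then show ?thesis unfolding minus_complex.sel Re_complex_of_real by linarith
  qed
  have "expectation (\<lambda>\<omega>. minorant N \<rho> (of_int q *\<^sub>R X \<omega>))
    = lam * Re (?I w) + (\<Sum>i\<in>UNIV. Re (?I (v i)))"
  proof -
    have i: "integrable M (\<lambda>\<omega>. Re (tpoly (nbox N) w (of_int q *\<^sub>R X \<omega>) * cnj (tpoly (nbox N) u (of_int q *\<^sub>R X \<omega>))))" for u
      by (intro integrable_Re integrable_tpoly_mult X)
    have eqs: "sin_poly N = tpoly (nbox N) w" "edge_poly N i = tpoly (nbox N) (v i)" for i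
      unfolding sin_poly_def edge_poly_def w_def v_def by simp_all
    show ?thesis
      unfolding minorant_eq[OF N0] lam[symmetric] eqs
      unfolding integral_Re[OF integrable_tpoly_mult[OF X], symmetric]
      by (subst Bochner_Integration.integral_add)
        (use i in \<open>auto intro!: Bochner_Integration.integrable_sum integrable_mult_right Bochner_Integration.integral_sum simp del: times_complex.sel complex_cnj\<close>)
  qed
  moreover have "lam * Re (?I w) \<ge> lam * (real L ^ ?k - real (N + 1) ^ ?k * ?E)"
  proof (rule mult_left_mono[OF _ lam0])
    have "(\<Sum>j\<in>nbox N. w j) * ?E \<le> real (N + 1) ^ ?k * ?E" using sw E0 by (rule mult_right_mono)
    then show "real L ^ ?k - real (N + 1) ^ ?k * ?E \<le> Re (?I w)"
      using Re_ge[of w, OF w0] unfolding sww by linarith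
  qed
  moreover have "(\<Sum>i\<in>(UNIV::'n set). Re (?I (v i))) \<ge> (\<Sum>i\<in>(UNIV::'n set). - (pi / (real N)\<^sup>2 * real (N + 1) ^ ?k * ?E))"
  proof (rule sum_mono)
    fix i
    have "(\<Sum>j\<in>nbox N. v i j) * ?E \<le> pi / (real N)\<^sup>2 * real (N + 1) ^ ?k * ?E" using sv E0 by (rule mult_right_mono)
    \<comment> \<open>All weights are nonnegative, so the diagonal of the cross term only helps and
      is dropped.\<close>
    moreover have "(\<Sum>j\<in>nbox N. w j * v i j) \<ge> 0" using w0 v0 by (intro sum_nonneg mult_nonneg_nonneg) auto
    ultimately show "- (pi / (real N)\<^sup>2 * real (N + 1) ^ ?k * ?E) \<le> Re (?I (v i))"
      using Re_ge[of "v i", OF v0] by linarith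
  qed
  ultimately show ?thesis by (simp add: algebra_simps)
qed

section \<open>Cylinders and Ahlfors regularity\<close>

lemma norm_le_card_mult:
  fixes x :: "real ^ 'n"
  assumes "\<And>i. \<bar>x $ i\<bar> \<le> r"
  shows "norm x \<le> real CARD('n) * r"
proof -
  have "norm x \<le> (\<Sum>i\<in>UNIV. \<bar>x $ i\<bar>)" by (rule norm_le_l1_cart)
  also have "\<dots> \<le> (\<Sum>i\<in>(UNIV::'n set). r)" by (intro sum_mono assms)
  finally show ?thesis by simp
qed

text \<open>Horner form of b^n times the expansion truncated after n digits, in coordinate
  i.\<close>

fun word_val :: "nat \<Rightarrow> nat \<Rightarrow> (nat \<Rightarrow> nat ^ 'n) \<Rightarrow> 'n \<Rightarrow> nat" where
  "word_val b 0 d i = 0"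
| "word_val b (Suc n) d i = b * word_val b n d i + d n $ i"

lemma word_val_cong: "(\<And>j. j < n \<Longrightarrow> d j = d' j) \<Longrightarrow> word_val b n d i = word_val b n d' i"
  by (induction n) auto

text \<open>The last digit is the remainder modulo b and the earlier digits are encoded in the
  quotient, so distinct words give distinct grid points.\<close>

lemma word_val_inject:
  fixes d d' :: "nat \<Rightarrow> nat ^ 'n"
  assumes "\<And>i. word_val b n d i = word_val b n d' i"
    and "\<And>j i. j < n \<Longrightarrow> d j $ i < b" "\<And>j i. j < n \<Longrightarrow> d' j $ i < b"
    and "j < n"
  shows "d j = d' j"
  using assms
proof (induction n arbitrary: j)
  case (Suc n)
  have eq: "b * word_val b n d i + d n $ i = b * word_val b n d' i + d' n $ i" for i
    using Suc.prems(1)[of i] by simp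
  have "d n $ i = d' n $ i \<and> word_val b n d i = word_val b n d' i" for i
  proof
    have lt: "d n $ i < b" "d' n $ i < b" using Suc.prems(2,3) by auto
    show "d n $ i = d' n $ i"
      using arg_cong[OF eq[of i], of "\<lambda>z. z mod b"] lt by simp
    show "word_val b n d i = word_val b n d' i"
      using arg_cong[OF eq[of i], of "\<lambda>z. z div b"] lt by simp
  qed
  then have "d n = d' n" and "\<And>i. word_val b n d i = word_val b n d' i" by (auto simp: vec_eq_iff)
  then show ?case using Suc.IH[of j] Suc.prems by (cases "j = n") auto
qed simp

section \<open>Digit expansions and masses of balls\<close>

locale missing_digits =
  fixes b :: nat and D :: "(nat ^ 'n) set"
  assumes b2: "b \<ge> 2" and D_ne: "D \<noteq> {}" and D_lt: "\<forall>d\<in>D. \<forall>i. d $ i < b"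
begin

abbreviation "K \<equiv> missing_digit_fractal b D"

text \<open>Estimates are made on the space of digit sequences, where cylinders have explicit mass;
  the image measure enters only through its Fourier coefficients.\<close>

abbreviation "P \<equiv> PiM (UNIV :: nat set) (\<lambda>_. measure_pmf (pmf_of_set D))"

abbreviation "X \<equiv> digit_sum b"

definition "kap = ln (real (card D)) / ln (real b)"

lemma finite_D: "finite D"
proof (rule finite_subset)
  show "D \<subseteq> {d. \<forall>i. d $ i \<in> {..<b}}" using D_lt by auto
qed (rule finite_vec_box, simp)

lemma card_D: "card D \<ge> 1"
  using finite_D D_ne by (simp add: Suc_leI card_gt_0_iff)

lemma b_powr_kap: "real b powr kap = real (card D)"
  using b2 card_D by (simp add: kap_def powr_def)

lemma summable_digits:
  assumes "\<And>j. d j \<in> D"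
  shows "summable (\<lambda>j. (real b) powi (- int (Suc j)) *\<^sub>R digit_vec (d j))"
proof (rule summable_comparison_test')
  show "summable (\<lambda>j. real CARD('n) * real b * (1 / real b) ^ Suc j)"
    using b2 by (intro summable_mult summable_ignore_initial_segment[where k=1, simplified] summable_geometric) auto
  fix j
  have "norm (digit_vec (d j)) \<le> real CARD('n) * real b"
    by (rule norm_le_card_mult) (use assms D_lt in \<open>auto simp: digit_vec_def less_imp_le\<close>)
  then have "(1 / real b) ^ Suc j * norm (digit_vec (d j)) \<le> (1 / real b) ^ Suc j * (real CARD('n) * real b)"
    by (intro mult_left_mono) auto
  moreover have "(real b) powi (- int (Suc j)) = (1 / real b) ^ Suc j"
    by (simp only: power_int_minus power_int_of_nat power_one_over inverse_eq_divide)
  ultimately show "norm ((real b) powi (- int (Suc j)) *\<^sub>R digit_vec (d j)) \<le> real CARD('n) * real b * (1 / real b) ^ Suc j"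
    by (simp add: mult_ac)
qed

lemma digit_sum_component:
  assumes "\<And>j. d j \<in> D"
  shows "(\<lambda>j. real (d j $ i) * (1 / real b) ^ Suc j) sums (X d $ i)"
proof -
  have e: "(real b) powi (- int (Suc j)) = (1 / real b) ^ Suc j" for j
    by (simp only: power_int_minus power_int_of_nat power_one_over inverse_eq_divide)
  have "(\<lambda>j. ((real b) powi (- int (Suc j)) *\<^sub>R digit_vec (d j)) $ i) sums (X d $ i)"
    unfolding digit_sum_def
    by (rule bounded_linear.sums[OF bounded_linear_vec_nth summable_sums[OF summable_digits[OF assms]]])
  then show ?thesis unfolding e by (simp add: digit_vec_def mult_ac)
qed

lemma digit_sum_bounds:
  assumes "\<And>j. d j \<in> D"
  shows "0 \<le> X d $ i" "X d $ i \<le> 1"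
proof -
  show "0 \<le> X d $ i"
    by (rule sums_le[OF _ sums_zero digit_sum_component[OF assms]]) auto
  have b1: "norm (1 / real b) < 1" using b2 by auto
  have "(\<lambda>j. (real b - 1) * (1 / real b) * (1 / real b) ^ j) sums ((real b - 1) * (1 / real b) * (1 / (1 - 1 / real b)))"
    by (rule sums_mult[OF geometric_sums[OF b1]])
  moreover have "(real b - 1) * (1 / real b) * (1 / (1 - 1 / real b)) = 1"
    using b2 by (simp add: field_simps)
  ultimately have s1: "(\<lambda>j. (real b - 1) * (1 / real b) * (1 / real b) ^ j) sums 1" by (simp only:)
  show "X d $ i \<le> 1"
  proof (rule sums_le[OF _ digit_sum_component[OF assms] s1])
    fix j
    have "d j $ i < b" using assms D_lt by auto
    then have "real (d j $ i) \<le> real b - 1" by linarith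
    then have "real (d j $ i) * (1 / real b) ^ Suc j \<le> (real b - 1) * (1 / real b) ^ Suc j"
      by (intro mult_right_mono) auto
    then show "real (d j $ i) * (1 / real b) ^ Suc j \<le> (real b - 1) * (1 / real b) * (1 / real b) ^ j" by simp
  qed
qed

lemma digit_sum_step:
  assumes "\<And>j. d j \<in> D"
  shows "real b * X d $ i = real (d 0 $ i) + X (\<lambda>j. d (Suc j)) $ i"
proof -
  have "(\<lambda>j. real (d (Suc j) $ i) * (1 / real b) ^ Suc j) sums (X (\<lambda>j. d (Suc j)) $ i)"
    by (rule digit_sum_component) (rule assms)
  from sums_mult[OF this, of "1 / real b"]
  have "(\<lambda>j. real (d (Suc j) $ i) * (1 / real b) ^ Suc (Suc j)) sums (1 / real b * X (\<lambda>j. d (Suc j)) $ i)"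
    by (simp add: mult_ac)
  from sums_Suc[OF this] have "(\<lambda>j. real (d j $ i) * (1 / real b) ^ Suc j)
    sums (1 / real b * X (\<lambda>j. d (Suc j)) $ i + real (d 0 $ i) * (1 / real b))" by simp
  then have "X d $ i = 1 / real b * X (\<lambda>j. d (Suc j)) $ i + real (d 0 $ i) * (1 / real b)"
    by (rule sums_unique2[OF digit_sum_component[of d, OF assms]])
  then show ?thesis using b2 by (simp add: field_simps)
qed

text \<open>Multiplication by b^n shifts the expansion: an integer plus a tail in [0, 1]. The tail
  can equal 1, so the integer need not be the floor.\<close>

lemma digit_sum_split:
  assumes "\<And>j. d j \<in> D"
  shows "real b ^ n * X d $ i = real (word_val b n d i) + X (\<lambda>j. d (j + n)) $ i"
proof (induction n)
  case (Suc n)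
  have "real b ^ Suc n * X d $ i = real b * real (word_val b n d i) + real b * X (\<lambda>j. d (j + n)) $ i"
    using Suc.IH by (simp add: mult.assoc distrib_left)
  also have "real b * X (\<lambda>j. d (j + n)) $ i = real (d n $ i) + X (\<lambda>j. d (j + Suc n)) $ i"
    using digit_sum_step[of "\<lambda>j. d (j + n)" i] assms by simp
  finally show ?case by simp
qed simp

lemma digit_sum_close:
  assumes "\<And>j. d j \<in> D" "\<And>j. d' j \<in> D" "\<And>j. j < n \<Longrightarrow> d j = d' j"
  shows "norm (X d - X d') \<le> real CARD('n) * (1 / real b) ^ n"
proof (rule norm_le_card_mult)
  fix i
  have w: "word_val b n d i = word_val b n d' i" by (rule word_val_cong) (rule assms(3))
  have "0 \<le> X (\<lambda>j. d (j + n)) $ i" "X (\<lambda>j. d (j + n)) $ i \<le> 1"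
    "0 \<le> X (\<lambda>j. d' (j + n)) $ i" "X (\<lambda>j. d' (j + n)) $ i \<le> 1"
    using assms by (auto intro!: digit_sum_bounds)
  then have "\<bar>real b ^ n * X d $ i - real b ^ n * X d' $ i\<bar> \<le> 1"
    using digit_sum_split[of d n i, OF assms(1)] digit_sum_split[of d' n i, OF assms(2)] w by linarith
  then have "real b ^ n * \<bar>(X d - X d') $ i\<bar> \<le> 1"
    using b2 by (simp add: right_diff_distrib[symmetric] abs_mult)
  then show "\<bar>(X d - X d') $ i\<bar> \<le> (1 / real b) ^ n"
    using b2 by (simp add: power_one_over field_simps)
qed

sublocale P: prob_space P
  by (intro prob_space_PiM measure_pmf.prob_space_axioms)

lemma space_P [simp]: "space P = UNIV"
  by (auto simp: space_PiM PiE_def)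

lemma X_measurable [measurable]: "X \<in> borel_measurable P"
proof -
  have 1: "(\<lambda>\<omega>. \<omega> j) \<in> measurable P (measure_pmf (pmf_of_set D))" for j :: nat
    by (rule measurable_component_singleton) simp
  have 2: "(\<lambda>\<omega>. digit_vec (\<omega> j)) \<in> borel_measurable P" for j :: nat
    by (rule measurable_compose[OF 1]) simp
  show ?thesis
    unfolding digit_sum_def[abs_def] by (intro borel_measurable_suminf borel_measurable_scaleR 2) simp
qed

text \<open>The sample space contains all sequences of natural vectors, while the series is
  controlled only for digits in \<open>D\<close>; hence the later arguments hold almost
  everywhere.\<close>

lemma AE_digits: "AE \<omega> in P. \<forall>j. \<omega> j \<in> D"
proof -
  have "AE \<omega> in P. \<omega> j \<in> D" for j :: nat
    by (rule AE_PiM_component)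
      (auto intro: measure_pmf.prob_space_axioms simp: AE_measure_pmf_iff set_pmf_of_set[OF D_ne finite_D])
  then show ?thesis by (simp add: AE_all_countable)
qed

lemma AE_in_K: "AE \<omega> in P. X \<omega> \<in> K"
  using AE_digits by eventually_elim (auto simp: missing_digit_fractal_def)

lemma prob_cylinder:
  assumes "\<And>j. j < n \<Longrightarrow> w j \<in> D"
  shows "{\<omega>. \<forall>j<n. \<omega> j = w j} \<in> P.events" "P.prob {\<omega>. \<forall>j<n. \<omega> j = w j} = (1 / real (card D)) ^ n"
proof -
  have eq: "{\<omega>. \<forall>j<n. \<omega> j = w j} = prod_emb UNIV (\<lambda>_. measure_pmf (pmf_of_set D)) {..<n} (PiE {..<n} (\<lambda>j. {w j}))"
    by (auto simp: prod_emb_iff PiE_iff)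
  show "{\<omega>. \<forall>j<n. \<omega> j = w j} \<in> P.events"
    unfolding eq by (intro sets_PiM_I) auto
  have "emeasure P {\<omega>. \<forall>j<n. \<omega> j = w j} = (\<Prod>j<n. emeasure (measure_pmf (pmf_of_set D)) {w j})"
    unfolding eq by (rule emeasure_PiM_emb) (auto intro: measure_pmf.prob_space_axioms)
  also have "\<dots> = (\<Prod>j<n. ennreal (1 / real (card D)))"
    using assms finite_D D_ne by (intro prod.cong) (auto simp: emeasure_pmf_single pmf_of_set)
  also have "\<dots> = ennreal ((1 / real (card D)) ^ n)"
    by (simp add: ennreal_power del: power_one_over)
  finally show "P.prob {\<omega>. \<forall>j<n. \<omega> j = w j} = (1 / real (card D)) ^ n"
    by (intro measure_eq_emeasure_eq_ennreal) auto
qed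

lemma power_powr_kap: "((1 / real b) ^ n) powr kap = (1 / real (card D)) ^ n"
proof -
  have "((1 / real b) ^ n) powr kap = ((1 / real b) powr kap) ^ n"
    using b2 by (simp add: powr_realpow[symmetric] powr_powr mult.commute)
  also have "(1 / real b) powr kap = 1 / real (card D)"
    using b2 by (simp add: powr_divide b_powr_kap)
  finally show ?thesis .
qed

lemma kap_nonneg: "kap \<ge> 0"
  using b2 card_D by (simp add: kap_def)

lemma cball_event [measurable]: "{\<omega>. X \<omega> \<in> cball y r} \<in> P.events"
proof -
  have "X -` cball y r \<inter> space P \<in> P.events"
    by (rule measurable_sets[OF X_measurable]) simp
  then show ?thesis by (simp add: vimage_def)
qed

text \<open>A cylinder around y whose diameter is at most r lies in the ball, and taking the
  shortest such word loses only the factors k^\<kappa> and \<open>card D\<close>.\<close>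

lemma prob_cball_ge:
  assumes y: "y \<in> K" and r: "0 < r" "r \<le> 1"
  shows "1 / (real CARD('n) powr kap * real (card D)) * r powr kap \<le> P.prob {\<omega>. X \<omega> \<in> cball y r}"
proof -
  obtain d where d: "\<And>j. d j \<in> D" "y = X d" using y by (auto simp: missing_digit_fractal_def)
  let ?k = "real CARD('n)"
  have k1: "?k \<ge> 1" by (simp add: Suc_leI)
  have "\<exists>n. ?k * (1 / real b) ^ n \<le> r"
  proof -
    have "\<exists>n. (1 / real b) ^ n < r / ?k" using b2 r k1 by (intro real_arch_pow_inv) auto
    then obtain n where "(1 / real b) ^ n < r / ?k" by blast
    then have "?k * (1 / real b) ^ n \<le> r" using k1 by (simp add: pos_less_divide_eq mult.commute)
    then show ?thesis by blast
  qed
  \<comment> \<open>Minimality gives the reverse inequality at n - 1; for n = 0 the assumption r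
    \<le> 1 takes its place.\<close>
  then obtain n where n: "?k * (1 / real b) ^ n \<le> r" and min: "\<And>m. m < n \<Longrightarrow> \<not> ?k * (1 / real b) ^ m \<le> r"
    using exists_least_iff[of "\<lambda>n. ?k * (1 / real b) ^ n \<le> r"] by auto
  have le: "r powr kap \<le> ?k powr kap * real (card D) * (1 / real (card D)) ^ n"
  proof (cases n)
    case 0
    have "r powr kap \<le> 1" using r kap_nonneg by (simp add: powr_le1)
    also have "1 \<le> ?k powr kap * real (card D)"
      using k1 kap_nonneg card_D mult_mono[of 1 "?k powr kap" 1 "real (card D)"] by (simp add: ge_one_powr_ge_zero)
    finally show ?thesis using 0 by simp
  next
    case (Suc m)
    have "r \<le> ?k * (1 / real b) ^ m" using min[of m] Suc by simp
    then have "r powr kap \<le> (?k * (1 / real b) ^ m) powr kap" using r kap_nonneg by (intro powr_mono2) auto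
    also have "\<dots> = ?k powr kap * (1 / real (card D)) ^ m" by (simp add: powr_mult power_powr_kap)
    also have "\<dots> = ?k powr kap * real (card D) * (1 / real (card D)) ^ n"
      using card_D Suc by simp
    finally show ?thesis .
  qed
  have "AE \<omega> in P. \<omega> \<in> {\<omega>. \<forall>j<n. \<omega> j = d j} \<longrightarrow> \<omega> \<in> {\<omega>. X \<omega> \<in> cball y r}"
    using AE_digits
  proof eventually_elim
    case (elim \<omega>)
    show ?case
    proof
      assume "\<omega> \<in> {\<omega>. \<forall>j<n. \<omega> j = d j}"
      then have "norm (X d - X \<omega>) \<le> ?k * (1 / real b) ^ n"
        using elim d by (intro digit_sum_close) auto
      then show "\<omega> \<in> {\<omega>. X \<omega> \<in> cball y r}" using n d by (simp add: dist_norm)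
    qed
  qed
  then have "P.prob {\<omega>. \<forall>j<n. \<omega> j = d j} \<le> P.prob {\<omega>. X \<omega> \<in> cball y r}"
    by (rule P.finite_measure_mono_AE) (rule cball_event)
  then have "(1 / real (card D)) ^ n \<le> P.prob {\<omega>. X \<omega> \<in> cball y r}"
    using prob_cylinder(2)[of n d] d by simp
  then have "?k powr kap * real (card D) * (1 / real (card D)) ^ n
    \<le> ?k powr kap * real (card D) * P.prob {\<omega>. X \<omega> \<in> cball y r}"
    by (intro mult_left_mono) auto
  with le have "r powr kap \<le> ?k powr kap * real (card D) * P.prob {\<omega>. X \<omega> \<in> cball y r}" by linarith
  moreover have "?k powr kap * real (card D) > 0" using k1 card_D by simp
  ultimately show ?thesis by (simp add: pos_divide_le_eq mult.commute)
qed

text \<open>The words of length n whose points can reach the ball sit on boundedly many grid points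
  near b^n y, and distinct words sit on distinct grid points. No relation between y and K enters, so
  rational centres off K are covered.\<close>

lemma prob_cball_le_scale:
  assumes r: "r \<le> (1 / real b) ^ n"
  shows "P.prob {\<omega>. X \<omega> \<in> cball y r} \<le> 5 ^ CARD('n) * (1 / real (card D)) ^ n"
proof -
  \<comment> \<open>In each coordinate b^n X is within 1 of b^n y and the tail lies in [0, 1], so
    the word value is between b^n y - 2 and b^n y + 1. Five integers around the floor contain this
    range.\<close>
  define A where "A i = {\<lfloor>real b ^ n * y $ i\<rfloor> - 2..\<lfloor>real b ^ n * y $ i\<rfloor> + 2}" for i
  define W where "W = {w \<in> PiE {..<n} (\<lambda>_. D). \<forall>i. int (word_val b n w i) \<in> A i}"
  have "finite (PiE {..<n} (\<lambda>_. D))" using finite_D by (intro finite_PiE) auto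
  then have finW: "finite W" unfolding W_def by (rule rev_finite_subset) blast
  have cW: "card W \<le> 5 ^ CARD('n)"
  proof -
    have "inj_on (\<lambda>w. \<chi> i. int (word_val b n w i)) W"
    proof (rule inj_onI)
      fix w w' assume w: "w \<in> W" "w' \<in> W" and eq: "(\<chi> i. int (word_val b n w i)) = (\<chi> i. int (word_val b n w' i))"
      have "word_val b n w i = word_val b n w' i" for i
        using eq by (simp add: vec_eq_iff)
      then have "w j = w' j" if "j < n" for j
        using word_val_inject[of b n w w' j] w D_lt that by (auto simp: W_def PiE_iff)
      then show "w = w'" using w by (intro PiE_ext[of w "{..<n}" "\<lambda>_. D" w']) (auto simp: W_def)
    qed
    then have "card W \<le> card {\<xi>::int^'n. \<forall>i. \<xi> $ i \<in> A i}"
    proof (rule card_inj_on_le)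
      show "finite {\<xi>::int^'n. \<forall>i. \<xi> $ i \<in> A i}" by (rule finite_vec_box) (simp add: A_def)
    qed (auto simp: W_def)
    also have "\<dots> = 5 ^ CARD('n)" by (subst card_vec_box) (auto simp: A_def)
    finally show ?thesis .
  qed
  have "AE \<omega> in P. \<omega> \<in> {\<omega>. X \<omega> \<in> cball y r} \<longrightarrow> \<omega> \<in> (\<Union>w\<in>W. {\<omega>. \<forall>j<n. \<omega> j = w j})"
    using AE_digits
  proof eventually_elim
    case (elim \<omega>)
    show ?case
    proof
      assume "\<omega> \<in> {\<omega>. X \<omega> \<in> cball y r}"
      then have dist: "norm (y - X \<omega>) \<le> r" by (simp add: dist_norm)
      define w where "w = restrict \<omega> {..<n}"
      have "int (word_val b n \<omega> i) \<in> A i" for i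
      proof -
        have "\<bar>y $ i - X \<omega> $ i\<bar> \<le> (1 / real b) ^ n"
          using component_le_norm_cart[of "y - X \<omega>" i] dist r by simp
        then have "real b ^ n * \<bar>y $ i - X \<omega> $ i\<bar> \<le> 1"
          using b2 by (simp add: power_one_over field_simps)
        then have "\<bar>real b ^ n * y $ i - real b ^ n * X \<omega> $ i\<bar> \<le> 1"
          using b2 by (simp add: right_diff_distrib[symmetric] abs_mult)
        moreover have "real b ^ n * X \<omega> $ i = real (word_val b n \<omega> i) + X (\<lambda>j. \<omega> (j + n)) $ i"
          by (rule digit_sum_split) (use elim in auto)
        moreover have "0 \<le> X (\<lambda>j. \<omega> (j + n)) $ i" "X (\<lambda>j. \<omega> (j + n)) $ i \<le> 1"
          using elim by (auto intro!: digit_sum_bounds)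
        ultimately have "real (word_val b n \<omega> i) \<ge> real b ^ n * y $ i - 2"
          "real (word_val b n \<omega> i) \<le> real b ^ n * y $ i + 1" by linarith+
        then show ?thesis unfolding A_def atLeastAtMost_iff by linarith
      qed
      moreover have "word_val b n w i = word_val b n \<omega> i" for i
        by (rule word_val_cong) (simp add: w_def)
      ultimately have "w \<in> W" using elim by (auto simp: W_def w_def)
      then show "\<omega> \<in> (\<Union>w\<in>W. {\<omega>. \<forall>j<n. \<omega> j = w j})" by (intro UN_I[of w]) (auto simp: w_def)
    qed
  qed
  moreover have ev: "{\<omega>. \<forall>j<n. \<omega> j = w j} \<in> P.events" if "w \<in> W" for w
    using that by (intro prob_cylinder) (auto simp: W_def)
  then have "(\<Union>w\<in>W. {\<omega>. \<forall>j<n. \<omega> j = w j}) \<in> P.events" using finW by (intro sets.finite_UN)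
  ultimately have "P.prob {\<omega>. X \<omega> \<in> cball y r} \<le> P.prob (\<Union>w\<in>W. {\<omega>. \<forall>j<n. \<omega> j = w j})"
    by (intro P.finite_measure_mono_AE)
  also have "\<dots> \<le> (\<Sum>w\<in>W. P.prob {\<omega>. \<forall>j<n. \<omega> j = w j})"
    using ev finW by (intro P.finite_measure_subadditive_finite) auto
  also have "\<dots> = real (card W) * (1 / real (card D)) ^ n"
  proof -
    have "P.prob {\<omega>. \<forall>j<n. \<omega> j = w j} = (1 / real (card D)) ^ n" if "w \<in> W" for w
      using that by (intro prob_cylinder(2)) (auto simp: W_def)
    then show ?thesis by simp
  qed
  also have "\<dots> \<le> 5 ^ CARD('n) * (1 / real (card D)) ^ n"
    using of_nat_mono[OF cW, where 'a = real] by (intro mult_right_mono) auto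
  finally show ?thesis .
qed

lemma prob_cball_le:
  assumes r: "0 < r"
  shows "P.prob {\<omega>. X \<omega> \<in> cball y r} \<le> 5 ^ CARD('n) * real (card D) * r powr kap"
proof (cases "r \<ge> 1")
  case True
  have "P.prob {\<omega>. X \<omega> \<in> cball y r} \<le> 1 * 1" using P.prob_le_1 by simp
  also have "\<dots> \<le> (5 ^ CARD('n) * real (card D)) * r powr kap"
  proof (rule mult_mono)
    show "1 \<le> 5 ^ CARD('n) * real (card D)"
      using card_D mult_mono[of 1 "5 ^ CARD('n)" 1 "real (card D)"] by simp
    show "1 \<le> r powr kap" using True kap_nonneg by (rule ge_one_powr_ge_zero)
  qed auto
  finally show ?thesis .
next
  case False
  \<comment> \<open>With n least, the scale n - 1 is still at least r; passing between the two
    scales costs the factor \<open>card D\<close>.\<close>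
  have "\<exists>n. (1 / real b) ^ n < r" using b2 r by (intro real_arch_pow_inv) auto
  then obtain n where n: "(1 / real b) ^ n < r" and min: "\<And>m. m < n \<Longrightarrow> \<not> (1 / real b) ^ m < r"
    using exists_least_iff[of "\<lambda>n. (1 / real b) ^ n < r"] by auto
  have "n \<noteq> 0" using n False by (intro notI) simp
  then obtain m where m: "n = Suc m" using not0_implies_Suc by blast
  have "P.prob {\<omega>. X \<omega> \<in> cball y r} \<le> 5 ^ CARD('n) * (1 / real (card D)) ^ m"
    using min[of m] m by (intro prob_cball_le_scale) auto
  also have "(1 / real (card D)) ^ m = real (card D) * (1 / real (card D)) ^ n"
    using m card_D by simp
  also have "(1 / real (card D)) ^ n = ((1 / real b) ^ n) powr kap" by (simp add: power_powr_kap)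
  also have "5 ^ CARD('n) * (real (card D) * ((1 / real b) ^ n) powr kap) \<le> 5 ^ CARD('n) * (real (card D) * r powr kap)"
    using n kap_nonneg by (intro mult_left_mono powr_mono2) auto
  finally show ?thesis by simp
qed

end

section \<open>Hausdorff dimension and Fourier decay\<close>

context missing_digits
begin

text \<open>The case \<open>r = 0\<close> is included because covering sets may have diameter \<open>0\<close>, and \<open>0 powr s = 0\<close> even for \<open>s = 0\<close>.\<close>

lemma prob_cball_le_closed:
  assumes "kap > 0" "r \<ge> 0"
  shows "P.prob {\<omega>. X \<omega> \<in> cball y r} \<le> 5 ^ CARD('n) * real (card D) * r powr kap"
proof (cases "r = 0")
  case True
  \<comment> \<open>A point lies in balls of every scale, and the bounds tend to 0 because positive
    \<open>kap\<close> forces more than one digit vector.\<close>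
  have "P.prob {\<omega>. X \<omega> \<in> cball y 0} \<le> 5 ^ CARD('n) * (1 / real (card D)) ^ n" for n
    by (rule prob_cball_le_scale) simp
  moreover have "(\<lambda>n. 5 ^ CARD('n) * (1 / real (card D)) ^ n) \<longlonglongrightarrow> 5 ^ CARD('n) * 0"
  proof (intro tendsto_mult tendsto_const LIMSEQ_power_zero)
    have "card D \<noteq> 1" using assms(1) by (auto simp: kap_def)
    then show "norm (1 / real (card D)) < 1" using card_D by simp
  qed
  ultimately have "P.prob {\<omega>. X \<omega> \<in> cball y 0} \<le> 5 ^ CARD('n) * 0"
    using LIMSEQ_le_const by blast
  then show ?thesis using True by simp
qed (use assms prob_cball_le in auto)

text \<open>Mass distribution principle: a cover by sets of diameter at most 1 carries total mass 1,
  and this mass is at most C times the s-sum of the diameters. The threshold 1 / C is what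
  contradicts it.\<close>

lemma hausdorff_measure_nonzero:
  assumes k0: "kap > 0" and s: "0 \<le> s" "s < kap"
  shows "hausdorff_measure s K \<noteq> 0"
proof
  define C where "C = 5 ^ CARD('n) * real (card D)"
  have C: "C > 0" using card_D by (simp add: C_def)
  assume "hausdorff_measure s K = 0"
  then have "hausdorff_approx s 1 K = 0"
    unfolding hausdorff_measure_def by (metis SUP_upper greaterThan_iff le_zero_eq zero_less_one)
  then have "hausdorff_approx s 1 K < ennreal (1 / C)" using C by simp
  then obtain U :: "nat \<Rightarrow> (real ^ 'n) set" where U: "K \<subseteq> (\<Union>i. U i)" "\<And>i. bounded (U i)" "\<And>i. diameter (U i) \<le> 1"
    and lt: "(\<Sum>i. ennreal (diameter (U i) powr s)) < ennreal (1 / C)"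
    unfolding hausdorff_approx_def INF_less_iff by auto
  \<comment> \<open>For an empty covering set the centre is arbitrary; this is harmless, since the
    extra ball only enlarges the union.\<close>
  define y where "y i = (SOME y. y \<in> U i)" for i
  have "AE \<omega> in P. \<omega> \<in> space P \<longrightarrow> \<omega> \<in> (\<Union>i. {\<omega>. X \<omega> \<in> cball (y i) (diameter (U i))})"
    using AE_in_K
  proof eventually_elim
    case (elim \<omega>)
    then obtain i where i: "X \<omega> \<in> U i" using U by auto
    then have "y i \<in> U i" unfolding y_def by (rule someI)
    then have "dist (y i) (X \<omega>) \<le> diameter (U i)" using diameter_bounded_bound[OF U(2)] i by blast
    then show ?case by auto
  qed
  then have "emeasure P (space P) \<le> emeasure P (\<Union>i. {\<omega>. X \<omega> \<in> cball (y i) (diameter (U i))})"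
    using cball_event by (intro emeasure_mono_AE sets.countable_UN) auto
  also have "\<dots> \<le> (\<Sum>i. emeasure P {\<omega>. X \<omega> \<in> cball (y i) (diameter (U i))})"
    using cball_event by (intro emeasure_subadditive_countably) auto
  also have "\<dots> \<le> (\<Sum>i. ennreal C * ennreal (diameter (U i) powr s))"
  proof (intro suminf_le summableI)
    fix i
    have d0: "diameter (U i) \<ge> 0" using U(2) by (rule diameter_ge_0)
    have "P.prob {\<omega>. X \<omega> \<in> cball (y i) (diameter (U i))} \<le> C * diameter (U i) powr kap"
      unfolding C_def by (rule prob_cball_le_closed[OF k0 d0])
    also have "\<dots> \<le> C * diameter (U i) powr s"
      using C d0 U(3)[of i] s by (intro mult_left_mono powr_mono') auto
    finally show "emeasure P {\<omega>. X \<omega> \<in> cball (y i) (diameter (U i))} \<le> ennreal C * ennreal (diameter (U i) powr s)"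
      using C by (simp add: P.emeasure_eq_measure ennreal_mult[symmetric])
  qed
  also have "\<dots> = ennreal C * (\<Sum>i. ennreal (diameter (U i) powr s))" by (rule ennreal_suminf_cmult)
  also have "\<dots> < ennreal C * ennreal (1 / C)"
    using lt C by (intro ennreal_mult_strict_left_mono) auto
  also have "\<dots> = 1" using C by (simp add: ennreal_mult[symmetric])
  finally show False using P.emeasure_space_1 by simp
qed

text \<open>Cover by all cylinders of length n: there are (card D)^n of them with diameter at most k
  b^(-n), and the s-sums decay geometrically with ratio card D / b^s < 1.\<close>

lemma hausdorff_measure_zero:
  assumes s: "kap < s"
  shows "hausdorff_measure s K = 0"
proof -
  let ?k = "real CARD('n)"
  have s0: "s > 0" using s kap_nonneg by linarith
  have bound: "hausdorff_approx s \<delta> K \<le> ennreal (real (card D) ^ n * (?k * (1 / real b) ^ n) powr s)"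
    if n: "?k * (1 / real b) ^ n \<le> \<delta>" for n \<delta>
  proof -
    define Wd where "Wd = PiE {..<n} (\<lambda>_. D)"
    have fin: "finite Wd" unfolding Wd_def using finite_D by (intro finite_PiE) auto
    have card: "card Wd = card D ^ n" unfolding Wd_def by (simp add: card_PiE)
    obtain h where h: "bij_betw h {0..<card Wd} Wd" using ex_bij_betw_nat_finite[OF fin] by blast
    define cyl where "cyl w = {X d | d. (\<forall>j. d j \<in> D) \<and> (\<forall>j<n. d j = w j)}" for w
    \<comment> \<open>The cover must be an infinite sequence; it is padded with empty sets, which
      contribute 0.\<close>
    define U where "U i = (if i < card Wd then cyl (h i) else {})" for i
    have close: "norm (x - y) \<le> ?k * (1 / real b) ^ n" if "x \<in> cyl w" "y \<in> cyl w" for x y w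
      using that by (auto simp: cyl_def intro!: digit_sum_close)
    have diam: "diameter (U i) \<le> ?k * (1 / real b) ^ n" for i
      unfolding U_def by (auto intro!: diameter_le close)
    have bdd: "bounded (U i)" for i
    proof (cases "U i = {}")
      case False
      then obtain x where x: "x \<in> U i" by blast
      then have "i < card Wd" by (auto simp: U_def split: if_splits)
      then have "U i \<subseteq> cball x (?k * (1 / real b) ^ n)"
        using x close[of x "h i"] by (auto simp: U_def dist_norm)
      then show ?thesis using bounded_subset bounded_cball by blast
    qed simp
    have cover: "K \<subseteq> (\<Union>i. U i)"
    proof
      fix x assume "x \<in> K"
      then obtain d where d: "\<And>j. d j \<in> D" "x = X d" by (auto simp: missing_digit_fractal_def)
      have "restrict d {..<n} \<in> Wd" using d by (auto simp: Wd_def)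
      then obtain i where i: "i < card Wd" "h i = restrict d {..<n}"
        using h by (metis atLeastLessThan_iff bij_betw_def imageE)
      then have "x \<in> U i" using d by (auto simp: U_def cyl_def)
      then show "x \<in> (\<Union>i. U i)" by blast
    qed
    have "hausdorff_approx s \<delta> K \<le> (\<Sum>i. ennreal (diameter (U i) powr s))"
      unfolding hausdorff_approx_def
      using cover bdd order_trans[OF diam n] by (intro INF_lower) auto
    also have "\<dots> = (\<Sum>i<card Wd. ennreal (diameter (U i) powr s))"
      using s0 by (intro suminf_finite) (auto simp: U_def)
    also have "\<dots> \<le> (\<Sum>i<card Wd. ennreal ((?k * (1 / real b) ^ n) powr s))"
      using diam diameter_ge_0[OF bdd] s0 by (intro sum_mono ennreal_leI powr_mono2) auto
    also have "\<dots> = ennreal (real (card D) ^ n * (?k * (1 / real b) ^ n) powr s)"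
      by (simp add: card ennreal_of_nat_eq_real_of_nat ennreal_mult'[symmetric])
    finally show ?thesis .
  qed
  define \<rho> where "\<rho> = real (card D) * (1 / real b) powr s"
  have eq: "real (card D) ^ n * (?k * (1 / real b) ^ n) powr s = ?k powr s * \<rho> ^ n" for n
  proof -
    have "((1 / real b) ^ n) powr s = ((1 / real b) powr s) ^ n"
      using b2 by (simp add: powr_realpow[symmetric] powr_powr mult.commute)
    then show ?thesis by (simp add: \<rho>_def powr_mult power_mult_distrib)
  qed
  have \<rho>: "0 \<le> \<rho>" "\<rho> < 1"
  proof -
    have "real b powr kap < real b powr s" using b2 s by (intro powr_less_mono) auto
    then show "\<rho> < 1" using b2 by (simp add: \<rho>_def b_powr_kap powr_divide)
  qed (simp add: \<rho>_def)
  have "hausdorff_approx s \<delta> K \<le> 0" if d: "\<delta> > 0" for \<delta>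
  proof (rule tendsto_lowerbound[where F = sequentially])
    have "(\<lambda>n. ?k powr s * \<rho> ^ n) \<longlonglongrightarrow> ?k powr s * 0"
      using \<rho> by (intro tendsto_mult tendsto_const LIMSEQ_power_zero) auto
    then have "(\<lambda>n. ennreal (?k powr s * \<rho> ^ n)) \<longlonglongrightarrow> ennreal 0"
      by (intro tendsto_ennrealI) simp
    then show "(\<lambda>n. ennreal (real (card D) ^ n * (?k * (1 / real b) ^ n) powr s)) \<longlonglongrightarrow> 0"
      by (simp add: eq)
    have "(\<lambda>n. ?k * (1 / real b) ^ n) \<longlonglongrightarrow> ?k * 0"
      using b2 by (intro tendsto_mult tendsto_const LIMSEQ_power_zero) auto
    then have "eventually (\<lambda>n. ?k * (1 / real b) ^ n < \<delta>) sequentially"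
      using d by (intro order_tendstoD) auto
    then show "eventually (\<lambda>n. hausdorff_approx s \<delta> K \<le> ennreal (real (card D) ^ n * (?k * (1 / real b) ^ n) powr s)) sequentially"
      by eventually_elim (rule bound, simp)
  qed simp
  then show ?thesis unfolding hausdorff_measure_def by (simp add: SUP_eq_iff bot_ennreal)
qed

lemma hausdorff_dim_K:
  assumes k0: "kap > 0"
  shows "hausdorff_dim K = kap"
proof -
  let ?S = "{s. s \<ge> 0 \<and> hausdorff_measure s K = 0}"
  have mem: "s \<in> ?S" if "s > kap" for s
    using that kap_nonneg hausdorff_measure_zero by auto
  have lb: "kap \<le> s" if "s \<in> ?S" for s
    using that hausdorff_measure_nonzero[OF k0, of s] by force
  have "Inf ?S \<ge> kap"
    using mem[of "kap + 1"] lb by (intro cInf_greatest) auto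
  moreover have "Inf ?S \<le> kap + e" if "e > 0" for e
    using mem[of "kap + e"] that lb by (intro cInf_lower bdd_belowI[of _ kap]) auto
  then have "Inf ?S \<le> kap" by (rule field_le_epsilon)
  ultimately show ?thesis unfolding hausdorff_dim_def by linarith
qed

lemma kap_pos:
  assumes "proper_fractal K"
  shows "kap > 0"
proof -
  obtain x y where "x \<in> K" "y \<in> K" "x \<noteq> y" using assms unfolding proper_fractal_def by blast
  then obtain d e where d: "\<And>j. d j \<in> D" "\<And>j. e j \<in> D" "X d \<noteq> X e"
    unfolding missing_digit_fractal_def by auto
  then have "d \<noteq> e" by auto
  then obtain j where "d j \<noteq> e j" by auto
  then have "card D > 1"
    using d finite_D by (metis One_nat_def card_le_Suc0_iff_eq not_le)
  then show ?thesis using b2 by (simp add: kap_def)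
qed

section \<open>Fourier coefficients and the frequency sum\<close>

lemma norm_fourier_coeff:
  "norm (fourier_coeff (cantor_lebesgue b D) \<xi>) = norm (P.expectation (\<lambda>\<omega>. ech \<xi> (X \<omega>)))"
proof -
  have e: "exp (- 2 * pi * \<i> * complex_of_real (\<Sum>i\<in>UNIV. real_of_int (\<xi> $ i) * x $ i)) = cnj (ech \<xi> x)" for x :: "real ^ 'n"
  proof -
    have "exp (- 2 * pi * \<i> * complex_of_real S) = cnj (cis (2 * pi * S))" for S
      by (simp add: complex_eq_iff Re_exp Im_exp)
    then show ?thesis unfolding ech_def .
  qed
  have "fourier_coeff (cantor_lebesgue b D) \<xi> = (LINT x|distr P borel X. cnj (ech \<xi> x))"
    unfolding fourier_coeff_def cantor_lebesgue_def e ..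
  also have "\<dots> = P.expectation (\<lambda>\<omega>. cnj (ech \<xi> (X \<omega>)))"
    by (intro integral_distr X_measurable borel_measurable_continuous_onI continuous_intros)
  also have "\<dots> = cnj (P.expectation (\<lambda>\<omega>. ech \<xi> (X \<omega>)))" by (rule Bochner_Integration.integral_cnj)
  finally show ?thesis by simp
qed

lemma norm_expectation_ech_le: "norm (P.expectation (\<lambda>\<omega>. ech \<xi> (X \<omega>))) \<le> 1"
proof -
  have "norm (P.expectation (\<lambda>\<omega>. ech \<xi> (X \<omega>))) \<le> P.expectation (\<lambda>\<omega>. norm (ech \<xi> (X \<omega>)))"
    by (rule integral_norm_bound)
  then show ?thesis using P.prob_space by simp
qed

definition freq_sum :: "real \<Rightarrow> real \<Rightarrow> real" where
  "freq_sum Q M = (\<Sum>q\<in>{1..\<lfloor>Q\<rfloor>}. \<Sum>m\<in>int_box M - {0}. norm (P.expectation (\<lambda>\<omega>. ech (q *s m) (X \<omega>))))"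

lemma freq_sum_mono: "M \<le> M' \<Longrightarrow> freq_sum Q M \<le> freq_sum Q M'"
  unfolding freq_sum_def using int_box_mono[of M M'] by (intro sum_mono sum_mono2) auto

text \<open>The gap between k - s and k / (k + 1) is split in half, and the half that is spent pays
  for the divisor bound.\<close>

lemma freq_sum_bound:
  assumes l1: "l1_dim (cantor_lebesgue b D) > real CARD('n) - real CARD('n) / (real CARD('n) + 1)"
  shows "\<exists>\<theta> C. 0 < \<theta> \<and> \<theta> < real CARD('n) / (real CARD('n) + 1) \<and> C > 0
    \<and> (\<forall>Q M. Q \<ge> 1 \<longrightarrow> M \<ge> 1 \<longrightarrow> freq_sum Q M \<le> C * (Q * M) powr \<theta>)"
proof -
  let ?k = "real CARD('n)"
  define A where "A \<xi> = norm (P.expectation (\<lambda>\<omega>. ech \<xi> (X \<omega>)))" for \<xi> :: "int ^ 'n"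
  define S where "S = {s. s \<ge> 0 \<and> (\<exists>C. \<forall>Q::real. Q \<ge> 1 \<longrightarrow> (\<Sum>\<xi>\<in>int_box Q. A \<xi>) \<le> C * Q powr (?k - s))}"
  have S: "l1_dim (cantor_lebesgue b D) = Sup S"
    unfolding l1_dim_def S_def norm_fourier_coeff A_def ..
  \<comment> \<open>The trivial bound 1 on all coefficients makes the set nonempty, so a member
    above the threshold can be taken from its supremum.\<close>
  have "0 \<in> S"
  proof -
    have "(\<Sum>\<xi>\<in>int_box Q. A \<xi>) \<le> 3 ^ CARD('n) * Q powr (?k - 0)" if "Q \<ge> 1" for Q
    proof -
      have "(\<Sum>\<xi>\<in>int_box Q. A \<xi>) \<le> (\<Sum>\<xi>\<in>(int_box Q::(int^'n) set). 1)"
        unfolding A_def by (intro sum_mono norm_expectation_ech_le)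
      also have "\<dots> \<le> (3 * Q) ^ CARD('n)" using card_int_box_le[OF that, where 'n = 'n] by simp
      finally show ?thesis using that by (simp add: powr_realpow power_mult_distrib)
    qed
    then show ?thesis unfolding S_def by (auto intro!: exI[of _ "3 ^ CARD('n)"])
  qed
  then obtain s where s: "s \<in> S" "?k - ?k / (?k + 1) < s"
    using less_cSupD[of S "?k - ?k / (?k + 1)"] l1 S by auto
  then obtain C where C: "\<And>Q::real. Q \<ge> 1 \<Longrightarrow> (\<Sum>\<xi>\<in>int_box Q. A \<xi>) \<le> C * Q powr (?k - s)"
    unfolding S_def by auto
  \<comment> \<open>Truncation at 0 keeps the final exponent positive whatever s is.\<close>
  define \<tau> where "\<tau> = max 0 (?k - s)"
  define \<epsilon> where "\<epsilon> = (?k / (?k + 1) - \<tau>) / 2"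
  have \<tau>: "0 \<le> \<tau>" "\<tau> < ?k / (?k + 1)" using s by (auto simp: \<tau>_def)
  then have \<epsilon>: "\<epsilon> > 0" by (simp add: \<epsilon>_def)
  obtain Cd where Cd: "Cd > 0" "\<And>n::nat. n > 0 \<Longrightarrow> real (card {q. q dvd n}) \<le> Cd * real n powr \<epsilon>"
    using divisor_bound[OF \<epsilon>] by blast
  show ?thesis
  proof (rule exI[of _ "\<tau> + \<epsilon>"], rule exI[of _ "Cd * (\<bar>C\<bar> + 1)"], intro conjI allI impI)
    show "\<tau> + \<epsilon> < ?k / (?k + 1)" using \<tau> unfolding \<epsilon>_def by argo
    show "0 < \<tau> + \<epsilon>" using \<tau> \<epsilon> by simp
    show "Cd * (\<bar>C\<bar> + 1) > 0" using Cd by simp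
    fix Q M :: real assume Q: "Q \<ge> 1" and M: "M \<ge> 1"
    have QM: "Q * M \<ge> 1" using mult_mono[of 1 Q 1 M] Q M by simp
    have "(\<Sum>\<xi>\<in>int_box (Q * M). A \<xi>) \<le> C * (Q * M) powr (?k - s)" by (rule C[OF QM])
    also have "\<dots> \<le> (\<bar>C\<bar> + 1) * (Q * M) powr \<tau>"
      using QM by (intro mult_mono powr_mono) (auto simp: \<tau>_def)
    finally have le: "(\<Sum>\<xi>\<in>int_box (Q * M). A \<xi>) \<le> (\<bar>C\<bar> + 1) * (Q * M) powr \<tau>" .
    have "freq_sum Q M \<le> Cd * (Q * M) powr \<epsilon> * (\<Sum>\<xi>\<in>int_box (Q * M). A \<xi>)"
      unfolding freq_sum_def A_def[symmetric]
      by (rule sum_multiples_le_divisor_weighted_sum) (use Cd \<epsilon> Q M in \<open>auto simp: A_def\<close>)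
    also have "\<dots> \<le> Cd * (Q * M) powr \<epsilon> * ((\<bar>C\<bar> + 1) * (Q * M) powr \<tau>)"
      using le Cd by (intro mult_left_mono) auto
    finally show "freq_sum Q M \<le> Cd * (\<bar>C\<bar> + 1) * (Q * M) powr (\<tau> + \<epsilon>)"
      by (simp add: powr_add mult_ac)
  qed
qed

text \<open>With N + 1 \<le> B / \<delta> the product Q (N + 1) is at most a constant times Q to the
  power 1 + 1/k + \<eta>. Its \<theta>-th power is of order Q to the power 1 - \<sigma>, so a large
  Q absorbs every constant, including the one from c.\<close>

lemma freq_sum_small:
  assumes \<theta>: "0 < \<theta>" "\<theta> * (1 + 1 / real CARD('n) + \<eta>) < 1"
    and fs: "\<And>Q M. Q \<ge> 1 \<Longrightarrow> M \<ge> 1 \<Longrightarrow> freq_sum Q M \<le> C * (Q * M) powr \<theta>"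
    and C: "C > 0" and c: "c > 0" and B: "B > 0" and \<tau>: "\<tau> > 0"
  shows "\<exists>Q0\<ge>1. \<forall>Q \<delta>. \<forall>N::nat. Q \<ge> Q0 \<longrightarrow> 0 < \<delta> \<longrightarrow> \<delta> \<ge> c * Q powr (- \<eta> - 1 / real CARD('n)) \<longrightarrow>
    real N + 1 \<le> B / \<delta> \<longrightarrow> freq_sum Q (real N) \<le> \<tau> * Q"
proof -
  let ?k = "real CARD('n)"
  define \<sigma> where "\<sigma> = 1 - \<theta> * (1 + 1 / ?k + \<eta>)"
  have \<sigma>: "\<sigma> > 0" using \<theta> by (simp add: \<sigma>_def)
  define H where "H = C * (B / c) powr \<theta> / \<tau>"
  have H: "H > 0" using C B c \<tau> by (simp add: H_def)
  show ?thesis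
  proof (intro exI[of _ "max 1 (H powr (1 / \<sigma>))"] conjI allI impI)
    fix Q \<delta> :: real and N :: nat
    assume Q: "max 1 (H powr (1 / \<sigma>)) \<le> Q" and \<delta>: "0 < \<delta>" "c * Q powr (- \<eta> - 1 / ?k) \<le> \<delta>"
      and N: "real N + 1 \<le> B / \<delta>"
    have Q1: "Q \<ge> 1" using Q by simp
    have "H = (H powr (1 / \<sigma>)) powr \<sigma>" using H \<sigma> by (simp add: powr_powr)
    also have "\<dots> \<le> Q powr \<sigma>" using Q \<sigma> by (intro powr_mono2) auto
    finally have HQ: "H \<le> Q powr \<sigma>" .
    have "Q * (real N + 1) \<le> Q * (B / (c * Q powr (- \<eta> - 1 / ?k)))"
    proof (rule mult_left_mono)
      have "B / \<delta> \<le> B / (c * Q powr (- \<eta> - 1 / ?k))"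
        using \<delta> B c Q1 by (intro divide_left_mono) auto
      with N show "real N + 1 \<le> B / (c * Q powr (- \<eta> - 1 / ?k))" by linarith
    qed (use Q1 in simp)
    also have "\<dots> = B / c * (Q powr 1 * Q powr (\<eta> + 1 / ?k))"
    proof -
      have "Q * (B / (c * Q powr (- p))) = B / c * (Q powr 1 * Q powr p)" for p
        using Q1 c by (simp add: powr_minus field_simps)
      from this[of "\<eta> + 1 / ?k"] show ?thesis by simp
    qed
    also have "\<dots> = B / c * Q powr (1 + 1 / ?k + \<eta>)"
      by (simp only: powr_add[symmetric] add_ac)
    finally have le: "Q * (real N + 1) \<le> B / c * Q powr (1 + 1 / ?k + \<eta>)" .
    \<comment> \<open>The estimate requires degree at least 1, but N can be 0 when \<delta> is not
      small.\<close>
    have "freq_sum Q (real N) \<le> freq_sum Q (real N + 1)" by (rule freq_sum_mono) simp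
    also have "\<dots> \<le> C * (Q * (real N + 1)) powr \<theta>" using Q1 by (intro fs) auto
    also have "\<dots> \<le> C * (B / c * Q powr (1 + 1 / ?k + \<eta>)) powr \<theta>"
      using le Q1 C \<theta> by (intro mult_left_mono powr_mono2) auto
    also have "\<dots> = \<tau> * (H * Q powr (\<theta> * (1 + 1 / ?k + \<eta>)))"
    proof -
      have "(u * Q powr p) powr \<theta> = u powr \<theta> * Q powr (\<theta> * p)" if "u > 0" for u p
        using that by (simp add: powr_mult powr_powr mult.commute)
      from this[of "B / c" "1 + 1 / ?k + \<eta>"] show ?thesis using \<tau> B c by (simp add: H_def)
    qed
    also have "\<dots> \<le> \<tau> * (Q powr \<sigma> * Q powr (\<theta> * (1 + 1 / ?k + \<eta>)))"
      using HQ \<tau> by (intro mult_left_mono mult_right_mono) auto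
    also have "\<dots> = \<tau> * Q" using Q1 by (simp add: powr_add[symmetric] \<sigma>_def)
    finally show "freq_sum Q (real N) \<le> \<tau> * Q" .
  qed simp
qed

end

section \<open>Counting rational points\<close>

lemma one_minus_cos_eq: "1 - cos x = 2 * (sin (x / 2))\<^sup>2" for x :: real
  using cos_double_sin[of "x / 2"] by simp

lemma one_minus_cos_le: "1 - cos x \<le> x\<^sup>2 / 2" for x :: real
proof -
  have "\<bar>sin (x / 2)\<bar>\<^sup>2 \<le> \<bar>x / 2\<bar>\<^sup>2" by (intro power_mono abs_sin_x_le_abs_x) simp
  then show ?thesis unfolding one_minus_cos_eq by (simp add: power_divide)
qed

text \<open>By the mean value theorem sin(\<pi> \<rho>) is \<pi> \<rho> times a cosine on
  [0, \<pi>/4], which is at least 2/3; with \<pi> > 3 this gives sin(\<pi> \<rho>) \<ge> 2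
  \<rho>.\<close>

lemma one_minus_cos_ge:
  assumes "0 < \<rho>" "\<rho> \<le> 1 / 4"
  shows "8 * \<rho>\<^sup>2 \<le> 1 - cos (2 * pi * \<rho>)"
proof -
  have "\<exists>z>0. z < pi * \<rho> \<and> sin (pi * \<rho>) - sin 0 = (pi * \<rho> - 0) * cos z"
    using assms by (intro MVT2) (auto intro!: derivative_eq_intros)
  then obtain z where z: "0 < z" "z < pi * \<rho>" "sin (pi * \<rho>) = pi * \<rho> * cos z" by auto
  have "pi * \<rho> \<le> pi / 4" using assms by simp
  then have "z \<le> pi / 4" using z by linarith
  then have "cos (pi / 4) \<le> cos z" using z by (intro cos_monotone_0_pi_le) auto
  moreover have "(2::real) / 3 \<le> sqrt 2 / 2"
    using real_le_rsqrt[of "4 / 3" 2] by (simp add: power2_eq_square)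
  ultimately have "2 / 3 \<le> cos z" by (simp add: cos_45)
  then have "3 * \<rho> * (2 / 3) \<le> pi * \<rho> * cos z"
    using assms pi_gt3 by (intro mult_mono) auto
  then have "2 * \<rho> \<le> sin (pi * \<rho>)" using z by simp
  then have "(2 * \<rho>)\<^sup>2 \<le> (sin (pi * \<rho>))\<^sup>2" using assms by (intro power_mono) auto
  then show ?thesis unfolding one_minus_cos_eq by (simp add: power_mult_distrib mult_ac)
qed

text \<open>Both left sides are of order k / N^2, and N \<ge> 2 k / \<rho> makes 4 k / N^2 at most
  \<rho>^2, while 1 - cos(2 \<pi> \<rho>) is at least 8 \<rho>^2. So at least half of the eigenvalue
  survives and the edge error stays comparable to it.\<close>

lemma minorant_constants:
  fixes k :: real
  assumes \<rho>: "0 < \<rho>" "\<rho> \<le> 1 / 4" and k: "k \<ge> 1" and N: "N \<ge> 2 * k / \<rho>"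
  shows "k * (1 - cos (pi / N)) \<le> (1 - cos (2 * pi * \<rho>)) / 2" "k * pi / N\<^sup>2 \<le> 1 - cos (2 * pi * \<rho>)"
proof -
  have N0: "N > 0" using N \<rho> k by (smt (verit) divide_pos_pos)
  have "(2 * k / \<rho>)\<^sup>2 \<le> N\<^sup>2" using N \<rho> k by (intro power_mono) auto
  then have "4 * k\<^sup>2 \<le> N\<^sup>2 * \<rho>\<^sup>2" using \<rho> by (simp add: power_divide power_mult_distrib pos_divide_le_eq)
  moreover have "k \<le> k\<^sup>2" using k by (simp add: power2_eq_square)
  ultimately have kN: "4 * k / N\<^sup>2 \<le> \<rho>\<^sup>2" using N0 by (simp add: pos_divide_le_eq mult.commute)
  define g where "g = 1 - cos (2 * pi * \<rho>)"
  have ge: "8 * \<rho>\<^sup>2 \<le> g" unfolding g_def by (rule one_minus_cos_ge[OF \<rho>])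
  have "pi\<^sup>2 \<le> 4\<^sup>2" using pi_less_4 by (intro power_mono) auto
  then have pi2: "pi\<^sup>2 \<le> 16" by simp
  have "k * (1 - cos (pi / N)) \<le> k * ((pi / N)\<^sup>2 / 2)"
    using k by (intro mult_left_mono one_minus_cos_le) auto
  also have "\<dots> = (k / N\<^sup>2) * (pi\<^sup>2 / 2)" by (simp add: power_divide)
  also have "\<dots> \<le> (k / N\<^sup>2) * 8" using pi2 k by (intro mult_left_mono) auto
  also have "\<dots> = 2 * (4 * k / N\<^sup>2)" by simp
  also have "\<dots> \<le> 2 * \<rho>\<^sup>2" using kN by (rule mult_left_mono) simp
  also have "\<dots> \<le> g / 2" using ge zero_le_power2[of \<rho>] by linarith
  finally show "k * (1 - cos (pi / N)) \<le> (1 - cos (2 * pi * \<rho>)) / 2" unfolding g_def .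
  have "k * pi / N\<^sup>2 = (k / N\<^sup>2) * pi" by simp
  also have "\<dots> \<le> (k / N\<^sup>2) * 4" using pi_less_4 k by (intro mult_left_mono) auto
  also have "\<dots> \<le> \<rho>\<^sup>2" using kN by (simp add: mult.commute)
  also have "\<dots> \<le> g" using ge zero_le_power2[of \<rho>] by linarith
  finally show "k * pi / N\<^sup>2 \<le> 1 - cos (2 * pi * \<rho>)" unfolding g_def .
qed

definition rat_pt :: "int ^ 'n \<Rightarrow> int \<Rightarrow> real ^ 'n" where
  "rat_pt a q = (\<chi> i. real_of_int (a $ i) / real_of_int q)"

lemma abs_scaled_diff_le:
  assumes "norm (rat_pt a q - x) \<le> r" "q > 0"
  shows "\<bar>(of_int q *\<^sub>R x) $ i - real_of_int (a $ i)\<bar> \<le> real_of_int q * r"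
proof -
  have "\<bar>real_of_int (a $ i) / real_of_int q - x $ i\<bar> \<le> r"
    using component_le_norm_cart[of "rat_pt a q - x" i] assms(1) by (simp add: rat_pt_def)
  then have "real_of_int q * \<bar>real_of_int (a $ i) / real_of_int q - x $ i\<bar> \<le> real_of_int q * r"
    using assms(2) by (intro mult_left_mono) auto
  moreover have "real_of_int q * \<bar>real_of_int (a $ i) / real_of_int q - x $ i\<bar>
    = \<bar>real_of_int q * (real_of_int (a $ i) / real_of_int q - x $ i)\<bar>"
    using assms(2) by (simp add: abs_mult)
  moreover have "real_of_int q * (real_of_int (a $ i) / real_of_int q - x $ i) = real_of_int (a $ i) - (of_int q *\<^sub>R x) $ i"
    using assms(2) by (simp add: right_diff_distrib)
  ultimately show ?thesis by (simp add: abs_minus_commute)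
qed

lemma norm_rat_pt_diff_le:
  fixes x :: "real ^ 'n"
  assumes "\<And>i. \<bar>(of_int q *\<^sub>R x) $ i - real_of_int (a $ i)\<bar> \<le> \<rho>" "q > 0"
  shows "norm (rat_pt a q - x) \<le> real CARD('n) * (\<rho> / real_of_int q)"
proof (rule norm_le_card_mult)
  fix i
  have "(rat_pt a q - x) $ i = - (((of_int q *\<^sub>R x) $ i - real_of_int (a $ i)) / real_of_int q)"
    using assms(2) by (simp add: rat_pt_def diff_divide_distrib)
  then have "\<bar>(rat_pt a q - x) $ i\<bar> = \<bar>(of_int q *\<^sub>R x) $ i - real_of_int (a $ i)\<bar> / real_of_int q"
    using assms(2) by simp
  then show "\<bar>(rat_pt a q - x) $ i\<bar> \<le> \<rho> / real_of_int q"
    using assms(1)[of i] assms(2) by (simp add: divide_right_mono)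
qed

lemma rat_points_near_iff:
  "(a, q) \<in> rat_points_near K Q \<delta> \<longleftrightarrow> 1 \<le> q \<and> real_of_int q \<le> Q \<and> infdist (rat_pt a q) K \<le> \<delta> / Q"
  by (simp add: rat_points_near_def rat_pt_def)

section \<open>Upper and lower counts near the fractal\<close>

context missing_digits
begin

lemma K_ne: "K \<noteq> {}"
  using D_ne unfolding missing_digit_fractal_def by auto

text \<open>Doubling the radius makes the inequality strict, so a point can be extracted from the
  infimum without compactness of K.\<close>

lemma rat_points_near_close:
  assumes "(a, q) \<in> rat_points_near K Q \<delta>" "0 < \<delta>" "Q \<ge> 1"
  obtains y where "y \<in> K" "norm (rat_pt a q - y) < 2 * (\<delta> / Q)"
proof -
  have "\<delta> / Q > 0" using assms by simp
  then have "infdist (rat_pt a q) K < 2 * (\<delta> / Q)"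
    using assms(1) unfolding rat_points_near_iff by linarith
  then have "\<exists>y\<in>K. dist (rat_pt a q) y < 2 * (\<delta> / Q)"
    using K_ne by (simp add: infdist_notempty cINF_less_iff)
  then show ?thesis using that by (auto simp: dist_norm)
qed

text \<open>Needed because \<open>card\<close> is 0 on infinite sets. Since K lies in the unit cube
  and a/q is within 2 of it, each numerator is at most 3 q in size.\<close>

lemma finite_rat_points_near:
  assumes "0 < \<delta>" "\<delta> < 1" "Q \<ge> 1"
  shows "finite (rat_points_near K Q \<delta>)"
proof (rule finite_subset)
  show "rat_points_near K Q \<delta> \<subseteq> int_box (3 * Q) \<times> {1..\<lfloor>Q\<rfloor>}"
  proof (rule subrelI)
    fix a q assume aq: "(a, q) \<in> rat_points_near K Q \<delta>"
    then have q: "1 \<le> q" "real_of_int q \<le> Q" by (auto simp: rat_points_near_iff)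
    obtain y where y: "y \<in> K" "norm (rat_pt a q - y) < 2 * (\<delta> / Q)"
      using rat_points_near_close[OF aq assms(1,3)] by blast
    have r: "\<delta> / Q \<le> 1" using assms by (simp add: pos_divide_le_eq)
    have "real_of_int \<bar>a $ i\<bar> \<le> 3 * Q" for i
    proof -
      have "norm (rat_pt a q - y) \<le> 2" using y r by linarith
      then have "\<bar>(of_int q *\<^sub>R y) $ i - real_of_int (a $ i)\<bar> \<le> real_of_int q * 2"
        using q by (intro abs_scaled_diff_le) auto
      moreover have "0 \<le> y $ i" "y $ i \<le> 1"
        using y digit_sum_bounds unfolding missing_digit_fractal_def by auto
      then have "0 \<le> (of_int q *\<^sub>R y) $ i" "(of_int q *\<^sub>R y) $ i \<le> real_of_int q"
        using q by (auto simp: mult_left_le)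
      ultimately show ?thesis using q by linarith
    qed
    then show "(a, q) \<in> int_box (3 * Q) \<times> {1..\<lfloor>Q\<rfloor>}"
      using q by (simp add: int_box_def le_floor_iff)
  qed
qed simp

lemma sum_rat_points_near_group:
  assumes "finite (rat_points_near K Q \<delta>)"
  shows "(\<Sum>p\<in>rat_points_near K Q \<delta>. f p) = (\<Sum>q\<in>{1..\<lfloor>Q\<rfloor>}. \<Sum>p\<in>{p\<in>rat_points_near K Q \<delta>. snd p = q}. f p)"
  by (rule sum.group[symmetric]) (use assms in \<open>auto simp: rat_points_near_iff le_floor_iff\<close>)

lemma expectation_count:
  assumes "finite R"
  shows "P.expectation (\<lambda>\<omega>. \<Sum>p\<in>R. indicator (cball (f p) r) (X \<omega>)) = (\<Sum>p\<in>R. P.prob {\<omega>. X \<omega> \<in> cball (f p) r})"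
    "integrable P (\<lambda>\<omega>. \<Sum>p\<in>R. indicator (cball (f p) r) (X \<omega>) :: real)"
proof -
  have e: "(\<lambda>\<omega>. indicator (cball y r) (X \<omega>) :: real) = indicator {\<omega>. X \<omega> \<in> cball y r}" for y
    by (auto simp: indicator_def)
  have i: "integrable P (\<lambda>\<omega>. indicator (cball y r) (X \<omega>) :: real)" for y
    unfolding e by (rule integrable_real_indicator[OF cball_event]) (simp add: P.emeasure_eq_measure)
  show "integrable P (\<lambda>\<omega>. \<Sum>p\<in>R. indicator (cball (f p) r) (X \<omega>) :: real)"
    using i by (intro Bochner_Integration.integrable_sum)
  have "P.expectation (\<lambda>\<omega>. indicator (cball y r) (X \<omega>)) = P.prob {\<omega>. X \<omega> \<in> cball y r}" for y
    unfolding e using Bochner_Integration.integral_indicator[of P "{\<omega>. X \<omega> \<in> cball y r}"] by simp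
  then show "P.expectation (\<lambda>\<omega>. \<Sum>p\<in>R. indicator (cball (f p) r) (X \<omega>)) = (\<Sum>p\<in>R. P.prob {\<omega>. X \<omega> \<in> cball (f p) r})"
    using i by (subst Bochner_Integration.integral_sum) auto
qed

text \<open>For each q boundedly many numerators can occur, and if one occurs then the trigonometric
  square is at least half its maximum.\<close>

lemma count_upper_pointwise:
  assumes \<delta>: "0 < \<delta>" "\<delta> < 1" and Q: "Q \<ge> 1" and N: "real CARD('n) * real N * (3 * \<delta>) \<le> 1 / 8"
  shows "(\<Sum>p\<in>rat_points_near K Q \<delta>. indicator (cball (rat_pt (fst p) (snd p)) (3 * (\<delta> / Q))) x)
    \<le> (\<Sum>q\<in>{1..\<lfloor>Q\<rfloor>}. 7 ^ CARD('n) * 2 / (real (N + 1) ^ CARD('n))\<^sup>2 * (norm (tpoly (nbox N) (\<lambda>_. 1) (of_int q *\<^sub>R x)))\<^sup>2)"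
  unfolding sum_rat_points_near_group[OF finite_rat_points_near[OF \<delta> Q]]
proof (rule sum_mono)
  let ?R = "rat_points_near K Q \<delta>"
  fix q assume q: "q \<in> {1..\<lfloor>Q\<rfloor>}"
  then have q1: "q \<ge> 1" "real_of_int q \<le> Q" by (auto simp: le_floor_iff)
  have finR: "finite ?R" by (rule finite_rat_points_near[OF \<delta> Q])
  let ?H = "{p\<in>?R. snd p = q \<and> x \<in> cball (rat_pt (fst p) (snd p)) (3 * (\<delta> / Q))}"
  have "(\<Sum>p\<in>{p\<in>?R. snd p = q}. indicator (cball (rat_pt (fst p) (snd p)) (3 * (\<delta> / Q))) x)
    = (\<Sum>p\<in>{p\<in>?R. snd p = q}. if x \<in> cball (rat_pt (fst p) (snd p)) (3 * (\<delta> / Q)) then 1 else (0::real))"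
    by (intro sum.cong) (auto simp: indicator_def)
  also have "\<dots> = real (card ?H)"
    using finR by (subst sum.inter_filter[symmetric]) (auto simp: conj_assoc)
  also have "\<dots> \<le> 7 ^ CARD('n) * 2 / (real (N + 1) ^ CARD('n))\<^sup>2 * (norm (tpoly (nbox N) (\<lambda>_. 1) (of_int q *\<^sub>R x)))\<^sup>2"
  proof (cases "?H = {}")
    case True
    then show ?thesis by (simp only: card.empty) simp
  next
    case False
    have close: "\<bar>(of_int q *\<^sub>R x) $ i - real_of_int (fst p $ i)\<bar> \<le> 3 * \<delta>" if "p \<in> ?H" for p i
    proof -
      have "\<bar>(of_int q *\<^sub>R x) $ i - real_of_int (fst p $ i)\<bar> \<le> real_of_int q * (3 * (\<delta> / Q))"
        using that q1 by (intro abs_scaled_diff_le) (auto simp: dist_norm)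
      also have "\<dots> \<le> Q * (3 * (\<delta> / Q))" using q1 \<delta> Q by (intro mult_right_mono) auto
      finally show ?thesis using Q by simp
    qed
    \<comment> \<open>A numerator is within 3 \<delta> < 3 of the coordinate of q x, which leaves at
      most seven integers.\<close>
    define A where "A i = {\<lfloor>(of_int q *\<^sub>R x) $ i\<rfloor> - 3..\<lfloor>(of_int q *\<^sub>R x) $ i\<rfloor> + 3}" for i
    have sub: "fst ` ?H \<subseteq> {a. \<forall>i. a $ i \<in> A i}"
    proof (rule image_subsetI, rule CollectI, rule allI)
      fix p i assume "p \<in> ?H"
      from close[OF this, of i] \<delta> show "fst p $ i \<in> A i"
        unfolding A_def atLeastAtMost_iff by linarith
    qed
    have fin: "finite {a::int^'n. \<forall>i. a $ i \<in> A i}" by (rule finite_vec_box) (simp add: A_def)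
    have inj: "inj_on fst ?H" by (rule inj_onI) (auto simp: prod_eq_iff)
    have "card ?H \<le> card {a::int^'n. \<forall>i. a $ i \<in> A i}" by (rule card_inj_on_le[OF inj sub fin])
    also have "\<dots> = 7 ^ CARD('n)" by (subst card_vec_box) (auto simp: A_def)
    finally have "real (card ?H) \<le> 7 ^ CARD('n)" using of_nat_mono by fastforce
    moreover obtain p where "p \<in> ?H" using False by blast
    then have "(real (N + 1) ^ CARD('n))\<^sup>2 / 2 \<le> (norm (tpoly (nbox N) (\<lambda>_. 1) (of_int q *\<^sub>R x)))\<^sup>2"
      using close N by (intro norm_tpoly_ge[of _ "fst p" "3 * \<delta>"]) auto
    then have "1 \<le> 2 / (real (N + 1) ^ CARD('n))\<^sup>2 * (norm (tpoly (nbox N) (\<lambda>_. 1) (of_int q *\<^sub>R x)))\<^sup>2"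
      by (simp add: field_simps del: of_nat_add)
    then have le: "7 ^ CARD('n) * 1 \<le> 7 ^ CARD('n) * (2 / (real (N + 1) ^ CARD('n))\<^sup>2 * (norm (tpoly (nbox N) (\<lambda>_. 1) (of_int q *\<^sub>R x)))\<^sup>2)"
      by (intro mult_left_mono) auto
    ultimately show ?thesis using order_trans[OF _ le] by (simp only: mult_1_right mult.assoc times_divide_eq_right times_divide_eq_left)
  qed
  finally show "(\<Sum>p\<in>{p\<in>?R. snd p = q}. indicator (cball (rat_pt (fst p) (snd p)) (3 * (\<delta> / Q))) x)
    \<le> 7 ^ CARD('n) * 2 / (real (N + 1) ^ CARD('n))\<^sup>2 * (norm (tpoly (nbox N) (\<lambda>_. 1) (of_int q *\<^sub>R x)))\<^sup>2" .
qed

lemma integrable_norm_tpoly: "integrable P (\<lambda>\<omega>. (norm (tpoly J u (of_int q *\<^sub>R X \<omega>)))\<^sup>2)"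
  unfolding norm_sq_eq_Re_mult_cnj by (intro integrable_Re P.integrable_tpoly_mult X_measurable)

text \<open>A ball of radius r around a nearby point of K lies in the ball of radius 3 r around the
  rational, so each rational carries mass of order at least r^\<kappa>. The degree is the largest
  one allowed by k N (3 \<delta>) \<le> 1/8, whence the 24.\<close>

lemma count_upper:
  assumes \<delta>: "0 < \<delta>" "\<delta> < 1" and Q: "Q \<ge> 1" and N: "N = nat \<lfloor>1 / (24 * real CARD('n) * \<delta>)\<rfloor>"
    and fs: "freq_sum Q (real N) \<le> Q"
  shows "real (card (rat_points_near K Q \<delta>)) * (1 / (real CARD('n) powr kap * real (card D)) * (\<delta> / Q) powr kap)
    \<le> 7 ^ CARD('n) * 4 * (24 * real CARD('n)) ^ CARD('n) * \<delta> ^ CARD('n) * Q"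
proof -
  let ?R = "rat_points_near K Q \<delta>" and ?k = "real CARD('n)" and ?r = "\<delta> / Q"
  let ?V = "real (N + 1) ^ CARD('n)"
  have k1: "?k \<ge> 1" by (simp add: Suc_leI)
  have finR: "finite ?R" by (rule finite_rat_points_near[OF \<delta> Q])
  have r: "0 < ?r" "?r \<le> 1" using \<delta> Q by (auto simp: pos_divide_le_eq)
  have "1 / (24 * ?k * \<delta>) \<ge> 0" using \<delta> by simp
  then have Nle: "real N \<le> 1 / (24 * ?k * \<delta>)" and Nge: "real (N + 1) \<ge> 1 / (24 * ?k * \<delta>)" unfolding N by linarith+
  have N1: "?k * real N * (3 * \<delta>) \<le> 1 / 8"
    using Nle k1 \<delta> by (simp add: field_simps)
  have V: "?V > 0" by simp
  have Vge: "1 / ?V \<le> (24 * ?k) ^ CARD('n) * \<delta> ^ CARD('n)"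
  proof -
    have "1 / real (N + 1) \<le> 24 * ?k * \<delta>" using Nge k1 \<delta> by (simp add: field_simps)
    then have "(1 / real (N + 1)) ^ CARD('n) \<le> (24 * ?k * \<delta>) ^ CARD('n)" by (intro power_mono) auto
    then show ?thesis by (simp add: power_one_over power_mult_distrib)
  qed
  have "real (card ?R) * (1 / (?k powr kap * real (card D)) * ?r powr kap)
    = (\<Sum>p\<in>?R. 1 / (?k powr kap * real (card D)) * ?r powr kap)" by simp
  also have "\<dots> \<le> (\<Sum>p\<in>?R. P.prob {\<omega>. X \<omega> \<in> cball (rat_pt (fst p) (snd p)) (3 * ?r)})"
  proof (rule sum_mono)
    fix p assume "p \<in> ?R"
    then have "(fst p, snd p) \<in> ?R" by simp
    then obtain y where y: "y \<in> K" "norm (rat_pt (fst p) (snd p) - y) < 2 * ?r"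
      using rat_points_near_close \<delta>(1) Q by blast
    have "cball y ?r \<subseteq> cball (rat_pt (fst p) (snd p)) (3 * ?r)"
    proof
      fix z assume "z \<in> cball y ?r"
      then have "dist y z \<le> ?r" by simp
      moreover have "dist (rat_pt (fst p) (snd p)) y < 2 * ?r" using y by (simp only: dist_norm)
      moreover have "dist (rat_pt (fst p) (snd p)) z \<le> dist (rat_pt (fst p) (snd p)) y + dist y z" by (rule dist_triangle)
      ultimately have "dist (rat_pt (fst p) (snd p)) z \<le> 3 * ?r" by linarith
      then show "z \<in> cball (rat_pt (fst p) (snd p)) (3 * ?r)" by (simp only: mem_cball)
    qed
    then have "P.prob {\<omega>. X \<omega> \<in> cball y ?r} \<le> P.prob {\<omega>. X \<omega> \<in> cball (rat_pt (fst p) (snd p)) (3 * ?r)}"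
      by (intro P.finite_measure_mono cball_event) blast
    with prob_cball_ge[OF y(1) r]
    show "1 / (?k powr kap * real (card D)) * ?r powr kap \<le> P.prob {\<omega>. X \<omega> \<in> cball (rat_pt (fst p) (snd p)) (3 * ?r)}"
      by linarith
  qed
  also have "\<dots> = P.expectation (\<lambda>\<omega>. \<Sum>p\<in>?R. indicator (cball (rat_pt (fst p) (snd p)) (3 * ?r)) (X \<omega>))"
    by (rule expectation_count(1)[OF finR, symmetric])
  also have "\<dots> \<le> P.expectation (\<lambda>\<omega>. \<Sum>q\<in>{1..\<lfloor>Q\<rfloor>}. 7 ^ CARD('n) * 2 / ?V\<^sup>2 * (norm (tpoly (nbox N) (\<lambda>_. 1) (of_int q *\<^sub>R X \<omega>)))\<^sup>2)"
    by (intro integral_mono expectation_count(2)[OF finR] count_upper_pointwise \<delta> Q N1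
        Bochner_Integration.integrable_sum integrable_mult_right integrable_norm_tpoly)
  also have "\<dots> = (\<Sum>q\<in>{1..\<lfloor>Q\<rfloor>}. 7 ^ CARD('n) * 2 / ?V\<^sup>2 * P.expectation (\<lambda>\<omega>. (norm (tpoly (nbox N) (\<lambda>_. 1) (of_int q *\<^sub>R X \<omega>)))\<^sup>2))"
    by (subst Bochner_Integration.integral_sum) (auto intro!: integrable_mult_right integrable_norm_tpoly)
  also have "\<dots> \<le> (\<Sum>q\<in>{1..\<lfloor>Q\<rfloor>}. 7 ^ CARD('n) * 2 / ?V\<^sup>2 * (?V * (1 + (\<Sum>m\<in>int_box (real N) - {0}. norm (P.expectation (\<lambda>\<omega>. ech (q *s m) (X \<omega>)))))))"
    by (intro sum_mono mult_left_mono P.expectation_norm_tpoly_le X_measurable) auto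
  also have "\<dots> = 7 ^ CARD('n) * 2 / ?V * (real_of_int \<lfloor>Q\<rfloor> + freq_sum Q (real N))"
  proof -
    have "7 ^ CARD('n) * 2 / ?V\<^sup>2 * (?V * z) = 7 ^ CARD('n) * 2 / ?V * z" for z
      using V by (simp add: power2_eq_square del: of_nat_add)
    then show ?thesis using Q
      by (simp only: sum_distrib_left[symmetric] sum.distrib freq_sum_def) simp
  qed
  \<comment> \<open>The zero frequencies give at most Q and the assumed error bound gives another
    Q.\<close>
  also have "\<dots> \<le> 7 ^ CARD('n) * 2 / ?V * (2 * Q)"
    using fs by (intro mult_left_mono) (auto intro: order_trans[OF add_mono[OF of_int_floor_le fs]])
  also have "\<dots> = 7 ^ CARD('n) * 4 * Q * (1 / ?V)" by simp
  also have "\<dots> \<le> 7 ^ CARD('n) * 4 * Q * ((24 * ?k) ^ CARD('n) * \<delta> ^ CARD('n))"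
    using Vge Q by (intro mult_left_mono) auto
  finally show ?thesis by (simp add: mult_ac)
qed

text \<open>In the tolerance \<delta> / (4 k), the k converts coordinates to the Euclidean norm and
  the 4 absorbs q \<ge> Q / 2; it also gives \<rho> \<le> 1/4, which the cosine bound requires
  later.\<close>

lemma count_lower_pointwise:
  assumes \<delta>: "0 < \<delta>" "\<delta> < 1" and Q: "Q \<ge> 1" and \<rho>: "\<rho> = \<delta> / (4 * real CARD('n))" and x: "x \<in> K"
  shows "(\<Sum>q\<in>{\<lceil>Q / 2\<rceil>..\<lfloor>Q\<rfloor>}. minorant N \<rho> (of_int q *\<^sub>R x))
    \<le> (1 - cos (2 * pi * \<rho>)) * (real (N + 1) ^ CARD('n))\<^sup>2
      * (\<Sum>p\<in>rat_points_near K Q \<delta>. indicator (cball (rat_pt (fst p) (snd p)) (\<delta> / Q)) x)"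
proof -
  let ?R = "rat_points_near K Q \<delta>" and ?k = "real CARD('n)"
  let ?G = "(1 - cos (2 * pi * \<rho>)) * (real (N + 1) ^ CARD('n))\<^sup>2"
  let ?ind = "\<lambda>p. indicator (cball (rat_pt (fst p) (snd p)) (\<delta> / Q)) x :: real"
  have finR: "finite ?R" by (rule finite_rat_points_near[OF \<delta> Q])
  have k1: "?k \<ge> 1" by (simp add: Suc_leI)
  have "\<delta> / (4 * ?k) \<le> \<delta> / (4 * 1)" using \<delta> k1 by (intro divide_left_mono) auto
  then have \<rho>0: "0 < \<rho>" "\<rho> \<le> 1 / 2" using \<delta> k1 unfolding \<rho> by (simp, linarith)
  have G0: "?G \<ge> 0" by (intro mult_nonneg_nonneg zero_le_power2) simp
  have "(\<Sum>q\<in>{\<lceil>Q / 2\<rceil>..\<lfloor>Q\<rfloor>}. minorant N \<rho> (of_int q *\<^sub>R x))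
    \<le> (\<Sum>q\<in>{\<lceil>Q / 2\<rceil>..\<lfloor>Q\<rfloor>}. ?G * (\<Sum>p\<in>{p\<in>?R. snd p = q}. ?ind p))"
  proof (rule sum_mono)
    fix q assume "q \<in> {\<lceil>Q / 2\<rceil>..\<lfloor>Q\<rfloor>}"
    then have q: "Q / 2 \<le> real_of_int q" "real_of_int q \<le> Q" by (auto simp: ceiling_le_iff le_floor_iff)
    then have q1: "q \<ge> 1" using Q by linarith
    show "minorant N \<rho> (of_int q *\<^sub>R x) \<le> ?G * (\<Sum>p\<in>{p\<in>?R. snd p = q}. ?ind p)"
    proof (cases "\<exists>a::int^'n. \<forall>i. \<bar>(of_int q *\<^sub>R x) $ i - real_of_int (a $ i)\<bar> \<le> \<rho>")
      case True
      then obtain a :: "int ^ 'n" where a: "\<And>i. \<bar>(of_int q *\<^sub>R x) $ i - real_of_int (a $ i)\<bar> \<le> \<rho>" by blast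
      have "norm (rat_pt a q - x) \<le> ?k * (\<rho> / real_of_int q)" using a q1 by (intro norm_rat_pt_diff_le) auto
      also have "\<dots> = \<delta> / (4 * real_of_int q)" using k1 by (simp add: \<rho>)
      also have "\<dots> \<le> \<delta> / Q" using q Q \<delta> by (intro divide_left_mono) auto
      finally have d: "dist (rat_pt a q) x \<le> \<delta> / Q" by (simp add: dist_norm)
      then have "infdist (rat_pt a q) K \<le> \<delta> / Q" using x by (intro infdist_le2) auto
      then have aR: "(a, q) \<in> {p\<in>?R. snd p = q}" using q q1 by (simp add: rat_points_near_iff)
      have "?ind (a, q) \<le> (\<Sum>p\<in>{p\<in>?R. snd p = q}. ?ind p)"
        using finR by (intro member_le_sum[OF aR]) auto
      then have ge: "1 \<le> (\<Sum>p\<in>{p\<in>?R. snd p = q}. ?ind p)" using d by simp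
      have "minorant N \<rho> (of_int q *\<^sub>R x) \<le> ?G * 1"
        using minorant_le[OF \<rho>0, of N "of_int q *\<^sub>R x"] True by (simp only: if_True mult_1_right)
      also have "\<dots> \<le> ?G * (\<Sum>p\<in>{p\<in>?R. snd p = q}. ?ind p)" by (rule mult_left_mono[OF ge G0])
      finally show ?thesis .
    next
      case False
      then have "minorant N \<rho> (of_int q *\<^sub>R x) \<le> 0"
        using minorant_le[OF \<rho>0, of N "of_int q *\<^sub>R x"] by (simp only: if_False)
      also have "0 \<le> ?G * (\<Sum>p\<in>{p\<in>?R. snd p = q}. ?ind p)"
        by (intro mult_nonneg_nonneg G0 sum_nonneg) auto
      finally show ?thesis .
    qed
  qed
  also have "\<dots> = ?G * (\<Sum>q\<in>{\<lceil>Q / 2\<rceil>..\<lfloor>Q\<rfloor>}. \<Sum>p\<in>{p\<in>?R. snd p = q}. ?ind p)"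
    by (rule sum_distrib_left[symmetric])
  also have "\<dots> \<le> ?G * (\<Sum>q\<in>{1..\<lfloor>Q\<rfloor>}. \<Sum>p\<in>{p\<in>?R. snd p = q}. ?ind p)"
  proof (rule mult_left_mono[OF sum_mono2 G0])
    have "\<lceil>Q / 2\<rceil> \<ge> 1" using Q by linarith
    then show "{\<lceil>Q / 2\<rceil>..\<lfloor>Q\<rfloor>} \<subseteq> {1..\<lfloor>Q\<rfloor>}" by auto
  qed (auto intro: sum_nonneg)
  finally show ?thesis unfolding sum_rat_points_near_group[OF finR, symmetric] .
qed

text \<open>The degree N = 2 L is chosen with N \<ge> 8 k^2 / \<delta> = 2 k / \<rho>, as the
  minorant constants demand. Integrating the pointwise bound and estimating the mass of each ball
  from above yields the count.\<close>

lemma count_lower: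
  assumes \<delta>: "0 < \<delta>" "\<delta> < 1" and Q: "Q \<ge> 4"
    and L: "L = nat \<lceil>4 * (real CARD('n))\<^sup>2 / \<delta>\<rceil>" and N: "N = 2 * L"
    and fs: "freq_sum Q (real N) \<le> 1 / (32 * 3 ^ CARD('n)) * Q"
  shows "1 / (16 * 3 ^ CARD('n) * (11 * (real CARD('n))\<^sup>2) ^ CARD('n)) * \<delta> ^ CARD('n) * Q
    \<le> real (card (rat_points_near K Q \<delta>)) * (5 ^ CARD('n) * real (card D) * (\<delta> / Q) powr kap)"
proof -
  let ?R = "rat_points_near K Q \<delta>" and ?k = "real CARD('n)" and ?r = "\<delta> / Q"
  let ?V = "real (N + 1) ^ CARD('n)" and ?I = "{\<lceil>Q / 2\<rceil>..\<lfloor>Q\<rfloor>}"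
  define \<rho> where "\<rho> = \<delta> / (4 * ?k)"
  define g where "g = 1 - cos (2 * pi * \<rho>)"
  define lam where "lam = g - ?k * (1 - cos (pi / real N))"
  define E where "E q = (\<Sum>m\<in>int_box (real N) - {0}. norm (P.expectation (\<lambda>\<omega>. ech (q *s m) (X \<omega>))))" for q
  have E0: "E q \<ge> 0" for q unfolding E_def by (intro sum_nonneg) auto
  have k1: "?k \<ge> 1" by (simp add: Suc_leI)
  have Q1: "Q \<ge> 1" using Q by simp
  have finR: "finite ?R" by (rule finite_rat_points_near[OF \<delta> Q1])
  have "\<delta> / (4 * ?k) \<le> \<delta> / (4 * 1)" using \<delta> k1 by (intro divide_left_mono) auto
  then have \<rho>0: "0 < \<rho>" "\<rho> \<le> 1 / 4" using \<delta> k1 unfolding \<rho>_def by (simp, linarith)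
  have kr: "4 * ?k\<^sup>2 / \<delta> = ?k / \<rho>" using \<delta> k1 by (simp add: \<rho>_def power2_eq_square)
  have pos: "4 * ?k\<^sup>2 / \<delta> > 0" using \<delta> k1 by simp
  have L0: "L > 0" using pos unfolding L by (simp add: zero_less_nat_eq)
  have Lge: "real L \<ge> 4 * ?k\<^sup>2 / \<delta>" and Lle: "real L \<le> 4 * ?k\<^sup>2 / \<delta> + 1" using pos unfolding L by linarith+
  have Nge: "real N \<ge> 2 * ?k / \<rho>" using Lge kr N by simp
  \<comment> \<open>Rounding gives N + 1 \<le> 8 k^2 / \<delta> + 3, and k^2 / \<delta> \<ge> 1
    absorbs the 3.\<close>
  have N1: "real (N + 1) \<le> 11 * ?k\<^sup>2 / \<delta>"
  proof -
    have "1 \<le> ?k\<^sup>2" using k1 by simp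
    then have "\<delta> \<le> ?k\<^sup>2" using \<delta> by linarith
    then have "1 \<le> ?k\<^sup>2 / \<delta>" using \<delta> by simp
    moreover have "real (N + 1) \<le> 8 * (?k\<^sup>2 / \<delta>) + 3" using Lle N by simp
    ultimately show ?thesis by simp
  qed
  have lam_ge: "lam \<ge> g / 2" and edge: "?k * pi / (real N)\<^sup>2 \<le> g"
    using minorant_constants[OF \<rho>0 k1 Nge, folded g_def] unfolding lam_def by linarith+
  have "0 < 8 * \<rho>\<^sup>2" using \<rho>0 by simp
  also have "\<dots> \<le> g" unfolding g_def by (rule one_minus_cos_ge[OF \<rho>0])
  finally have g0: "g > 0" .
  have "?k * (1 - cos (pi / real N)) \<ge> 0" by simp
  then have lam_le: "lam \<le> g" unfolding lam_def by linarith
  have V: "?V > 0" by simp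
  have LV: "real L ^ CARD('n) \<ge> ?V / 3 ^ CARD('n)"
  proof -
    have "real (N + 1) / 3 \<le> real L" using L0 N by simp
    then have "(real (N + 1) / 3) ^ CARD('n) \<le> real L ^ CARD('n)" by (intro power_mono) auto
    then show ?thesis by (simp add: power_divide)
  qed
  have term_ge: "g * ?V * (1 / (2 * 3 ^ CARD('n)) - 2 * E q) \<le> P.expectation (\<lambda>\<omega>. minorant N \<rho> (of_int q *\<^sub>R X \<omega>))" for q
  proof -
    have "g / 2 * (?V / 3 ^ CARD('n)) \<le> lam * real L ^ CARD('n)"
      using lam_ge LV g0 by (intro mult_mono) auto
    moreover have "(lam + ?k * pi / (real N)\<^sup>2) * ?V * E q \<le> (2 * g) * ?V * E q"
      using lam_le edge E0 by (intro mult_right_mono) auto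
    moreover have "lam * real L ^ CARD('n) - (lam + ?k * pi / (real N)\<^sup>2) * ?V * E q
      \<le> P.expectation (\<lambda>\<omega>. minorant N \<rho> (of_int q *\<^sub>R X \<omega>))"
      unfolding E_def
      by (rule P.expectation_minorant_ge[OF X_measurable N L0]) (use lam_ge g0 in \<open>auto simp: lam_def g_def\<close>)
    ultimately have "g / 2 * (?V / 3 ^ CARD('n)) - (2 * g) * ?V * E q \<le> P.expectation (\<lambda>\<omega>. minorant N \<rho> (of_int q *\<^sub>R X \<omega>))"
      by linarith
    then show ?thesis by (simp add: algebra_simps)
  qed
  \<comment> \<open>Rounding at both ends leaves at least Q / 2 - 1 integers; Q \<ge> 4 makes this
    at least Q / 4.\<close>
  have cI: "real (card ?I) \<ge> Q / 4"
  proof -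
    have "real_of_int (\<lfloor>Q\<rfloor> - \<lceil>Q / 2\<rceil> + 1) \<ge> Q / 4" using Q by linarith
    then show ?thesis by simp
  qed
  have EI: "(\<Sum>q\<in>?I. E q) \<le> 1 / (32 * 3 ^ CARD('n)) * Q"
  proof -
    have "\<lceil>Q / 2\<rceil> \<ge> 1" using Q by linarith
    then have "(\<Sum>q\<in>?I. E q) \<le> freq_sum Q (real N)"
      unfolding freq_sum_def E_def[symmetric] using E0 by (intro sum_mono2) auto
    with fs show ?thesis by linarith
  qed
  \<comment> \<open>The main term is at least Q / (8 3^k); the allowance 1 / (32 3^k), doubled, uses
    up half of it.\<close>
  have "g * ?V * (Q / (16 * 3 ^ CARD('n))) \<le> g * ?V * (real (card ?I) * (1 / (2 * 3 ^ CARD('n))) - 2 * (\<Sum>q\<in>?I. E q))"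
  proof (rule mult_left_mono)
    have "Q / 4 * (1 / (2 * 3 ^ CARD('n))) \<le> real (card ?I) * (1 / (2 * 3 ^ CARD('n)))"
      using cI by (intro mult_right_mono) auto
    then show "Q / (16 * 3 ^ CARD('n)) \<le> real (card ?I) * (1 / (2 * 3 ^ CARD('n))) - 2 * (\<Sum>q\<in>?I. E q)"
      using EI by simp
  qed (use g0 V in auto)
  also have "\<dots> = (\<Sum>q\<in>?I. g * ?V * (1 / (2 * 3 ^ CARD('n)) - 2 * E q))"
    by (simp only: sum_distrib_left[symmetric] sum_subtractf sum_constant)
  also have "\<dots> \<le> (\<Sum>q\<in>?I. P.expectation (\<lambda>\<omega>. minorant N \<rho> (of_int q *\<^sub>R X \<omega>)))"
    by (intro sum_mono term_ge)
  also have "\<dots> = P.expectation (\<lambda>\<omega>. \<Sum>q\<in>?I. minorant N \<rho> (of_int q *\<^sub>R X \<omega>))"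
    using L0 N by (intro Bochner_Integration.integral_sum[symmetric] P.integrable_minorant X_measurable) auto
  also have "\<dots> \<le> P.expectation (\<lambda>\<omega>. g * ?V\<^sup>2 * (\<Sum>p\<in>?R. indicator (cball (rat_pt (fst p) (snd p)) ?r) (X \<omega>)))"
  proof (rule integral_mono_AE)
    show "AE \<omega> in P. (\<Sum>q\<in>?I. minorant N \<rho> (of_int q *\<^sub>R X \<omega>))
      \<le> g * ?V\<^sup>2 * (\<Sum>p\<in>?R. indicator (cball (rat_pt (fst p) (snd p)) ?r) (X \<omega>))"
      using AE_in_K unfolding g_def
      by eventually_elim (rule count_lower_pointwise[OF \<delta> Q1 \<rho>_def])
  qed (use L0 N in \<open>auto intro!: Bochner_Integration.integrable_sum P.integrable_minorant X_measurable
        integrable_mult_right expectation_count(2)[OF finR] simp del: of_nat_add of_nat_Suc\<close>)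
  also have "\<dots> = g * ?V\<^sup>2 * (\<Sum>p\<in>?R. P.prob {\<omega>. X \<omega> \<in> cball (rat_pt (fst p) (snd p)) ?r})"
    by (subst integral_mult_right_zero) (simp only: expectation_count(1)[OF finR])
  also have "\<dots> \<le> g * ?V\<^sup>2 * (\<Sum>p\<in>?R. 5 ^ CARD('n) * real (card D) * ?r powr kap)"
    using g0 \<delta> Q by (intro mult_left_mono sum_mono prob_cball_le) auto
  finally have "g * ?V * (Q / (16 * 3 ^ CARD('n))) \<le> g * ?V * (?V * (real (card ?R) * (5 ^ CARD('n) * real (card D) * ?r powr kap)))"
    by (simp only: power2_eq_square mult.assoc sum_constant)
  \<comment> \<open>The minorant has height g V^2 and mean of order g V, so the small factor g
    cancels and one power of V, of order \<delta>^(-k), remains.\<close>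
  then have le: "Q / (16 * 3 ^ CARD('n)) \<le> ?V * (real (card ?R) * (5 ^ CARD('n) * real (card D) * ?r powr kap))"
    using g0 V by (subst (asm) mult_le_cancel_left_pos) auto
  have "?V \<le> (11 * ?k\<^sup>2) ^ CARD('n) / \<delta> ^ CARD('n)"
    using power_mono[OF N1, of "CARD('n)"] by (simp add: power_divide)
  then have "?V * (real (card ?R) * (5 ^ CARD('n) * real (card D) * ?r powr kap))
    \<le> (11 * ?k\<^sup>2) ^ CARD('n) / \<delta> ^ CARD('n) * (real (card ?R) * (5 ^ CARD('n) * real (card D) * ?r powr kap))"
    by (intro mult_right_mono) auto
  with le have le2: "Q / (16 * 3 ^ CARD('n)) \<le> (11 * ?k\<^sup>2) ^ CARD('n) / \<delta> ^ CARD('n) * (real (card ?R) * (5 ^ CARD('n) * real (card D) * ?r powr kap))"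
    by linarith
  have pos2: "(11 * ?k\<^sup>2) ^ CARD('n) > 0" "\<delta> ^ CARD('n) > 0" using k1 \<delta> by auto
  have gen: "1 / (s * v) * d * Q \<le> t" if "Q / s \<le> v / d * t" "v > 0" "d > 0" "s > 0" for s v d t :: real
    using that by (simp add: field_simps)
  show ?thesis by (rule gen[OF le2 pos2]) simp
qed

end

section \<open>Assembling the constants\<close>

context missing_digits
begin

text \<open>Turns estimates of the count times (\<delta> / Q)^\<kappa> into the powers of \<delta>
  and Q of the final bound.\<close>

lemma scaling_identity:
  assumes "0 < \<delta>" "0 < Q"
  shows "\<delta> ^ CARD('n) * Q = \<delta> powr (real CARD('n) - kap) * Q powr (kap + 1) * (\<delta> / Q) powr kap"
  using assms by (simp add: powr_diff powr_add powr_divide powr_realpow)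

lemma count_bounds:
  assumes l1: "l1_dim (cantor_lebesgue b D) > real CARD('n) - real CARD('n) / (real CARD('n) + 1)"
  shows "\<exists>\<eta>>0. \<forall>c>0. \<exists>Q0\<ge>1. \<exists>C1 C2. 0 < C1 \<and> C1 \<le> C2 \<and>
    (\<forall>Q \<delta>. Q \<ge> Q0 \<longrightarrow> 0 < \<delta> \<longrightarrow> \<delta> < 1 \<longrightarrow> \<delta> \<ge> c * Q powr (- \<eta> - 1 / real CARD('n)) \<longrightarrow>
      C1 * \<delta> powr (real CARD('n) - kap) * Q powr (kap + 1) \<le> real (card (rat_points_near K Q \<delta>)) \<and>
      real (card (rat_points_near K Q \<delta>)) \<le> C2 * \<delta> powr (real CARD('n) - kap) * Q powr (kap + 1))"
proof -
  let ?k = "real CARD('n)"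
  have k1: "?k \<ge> 1" by (simp add: Suc_leI)
  obtain \<theta> C where \<theta>: "0 < \<theta>" "\<theta> < ?k / (?k + 1)" and C: "C > 0"
    and fs: "\<And>Q M. Q \<ge> 1 \<Longrightarrow> M \<ge> 1 \<Longrightarrow> freq_sum Q M \<le> C * (Q * M) powr \<theta>"
    using freq_sum_bound[OF l1] by blast
  \<comment> \<open>Half of the largest admissible value, so \<theta> (1 + 1/k + \<eta>) is the
    average of \<theta> (1 + 1/k) and 1. It depends on \<theta> alone and is fixed before c.\<close>
  define \<eta> where "\<eta> = (1 / \<theta> - (1 + 1 / ?k)) / 2"
  have inv: "p / (p + 1) * (1 + 1 / p) = 1" if "p > 0" for p :: real
  proof -
    have "1 + 1 / p = (p + 1) / p" "p + 1 \<noteq> 0" using that by (auto simp: add_divide_distrib)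
    then show ?thesis using that by simp
  qed
  have "\<theta> * (1 + 1 / ?k) < ?k / (?k + 1) * (1 + 1 / ?k)"
    using \<theta> k1 by (intro mult_strict_right_mono) (auto intro: add_pos_nonneg)
  then have lt: "\<theta> * (1 + 1 / ?k) < 1" unfolding inv[OF less_le_trans[OF zero_less_one k1]] .
  then have \<eta>: "\<eta> > 0" using \<theta> by (simp add: \<eta>_def pos_less_divide_eq mult.commute)
  have "\<theta> * (1 + 1 / ?k + \<eta>) = \<theta> * (1 + 1 / ?k) / 2 + 1 / 2"
  proof -
    have "\<theta> * (p + (1 / \<theta> - p) / 2) = \<theta> * p / 2 + 1 / 2" for p using \<theta> by (simp add: field_simps)
    then show ?thesis unfolding \<eta>_def .
  qed
  moreover have "x / 2 + 1 / 2 < 1" if "x < 1" for x :: real using that by simp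
  ultimately have \<theta>\<eta>: "\<theta> * (1 + 1 / ?k + \<eta>) < 1" using lt by metis
  define a1 where "a1 = 1 / (?k powr kap * real (card D))"
  define a2 where "a2 = 5 ^ CARD('n) * real (card D)"
  define U where "U = 7 ^ CARD('n) * 4 * (24 * ?k) ^ CARD('n)"
  define V where "V = 1 / (16 * 3 ^ CARD('n) * (11 * ?k\<^sup>2) ^ CARD('n))"
  have pos: "a1 > 0" "a2 > 0" "U > 0" "V > 0"
    using card_D k1 by (auto simp: a1_def a2_def U_def V_def)
  show ?thesis
  proof (rule exI[of _ \<eta>], rule conjI[OF \<eta>], intro allI impI)
    fix c :: real assume c: "c > 0"
    \<comment> \<open>For the upper count N + 1 \<le> 2 / \<delta> suffices, since both 1 and 1 /
      (24 k \<delta>) are at most 1 / \<delta>.\<close>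
    obtain Qa where Qa: "\<And>Q \<delta> (N::nat). Q \<ge> Qa \<Longrightarrow> 0 < \<delta> \<Longrightarrow> \<delta> \<ge> c * Q powr (- \<eta> - 1 / ?k) \<Longrightarrow>
        real N + 1 \<le> 2 / \<delta> \<Longrightarrow> freq_sum Q (real N) \<le> 1 * Q"
      using freq_sum_small[OF \<theta>(1) \<theta>\<eta> fs C c, of 2 1] by auto
    have B: "11 * ?k\<^sup>2 > 0" and \<tau>: "1 / (32 * 3 ^ CARD('n)) > (0::real)" using k1 by auto
    obtain Qb where Qb: "\<And>Q \<delta> (N::nat). Q \<ge> Qb \<Longrightarrow> 0 < \<delta> \<Longrightarrow> \<delta> \<ge> c * Q powr (- \<eta> - 1 / ?k) \<Longrightarrow>
        real N + 1 \<le> 11 * ?k\<^sup>2 / \<delta> \<Longrightarrow> freq_sum Q (real N) \<le> 1 / (32 * 3 ^ CARD('n)) * Q"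
      using freq_sum_small[OF \<theta>(1) \<theta>\<eta> fs C c B \<tau>] by blast
    \<comment> \<open>The maximum in the upper constant guarantees that it is not below the lower
      one; the 4 in the threshold for Q serves the lower count.\<close>
    have main: "V / a2 * \<delta> powr (?k - kap) * Q powr (kap + 1) \<le> real (card (rat_points_near K Q \<delta>))
      \<and> real (card (rat_points_near K Q \<delta>)) \<le> max (V / a2) (U / a1) * \<delta> powr (?k - kap) * Q powr (kap + 1)"
      if Q: "Q \<ge> max 4 (max Qa Qb)" and \<delta>: "0 < \<delta>" "\<delta> < 1" "\<delta> \<ge> c * Q powr (- \<eta> - 1 / ?k)" for Q \<delta>
    proof -
      let ?n = "real (card (rat_points_near K Q \<delta>))"
      define T where "T = \<delta> powr (?k - kap) * Q powr (kap + 1)"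
      define R where "R = (\<delta> / Q) powr kap"
      have Q4: "Q \<ge> 4" "Q \<ge> Qa" "Q \<ge> Qb" using Q by auto
      have R0: "R > 0" using \<delta> Q4 by (simp add: R_def)
      have T0: "T \<ge> 0" by (simp add: T_def)
      have id: "\<delta> ^ CARD('n) * Q = T * R"
        unfolding T_def R_def using \<delta> Q4 by (intro scaling_identity) auto
      have "?n * (a1 * R) \<le> U * \<delta> ^ CARD('n) * Q"
        unfolding a1_def R_def U_def
      proof (rule count_upper[OF \<delta>(1,2) _ refl])
        let ?N = "nat \<lfloor>1 / (24 * ?k * \<delta>)\<rfloor>"
        have "1 * \<delta> \<le> 24 * ?k * \<delta>" using k1 \<delta>(1) by (intro mult_right_mono) linarith+
        then have "\<delta> \<le> 24 * ?k * \<delta>" by simp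
        then have "1 / (24 * ?k * \<delta>) \<le> 1 / \<delta>" using \<delta>(1) by (intro divide_left_mono) auto
        moreover have "1 \<le> 1 / \<delta>" using \<delta> by simp
        moreover have "0 \<le> 1 / (24 * ?k * \<delta>)" using \<delta> by simp
        ultimately have "real ?N + 1 \<le> 2 * (1 / \<delta>)" by linarith
        then show "freq_sum Q (real ?N) \<le> Q" using Qa[OF Q4(2) \<delta>(1,3)] by simp
      qed (use Q4 in simp)
      also have "\<dots> = U * T * R" using id by (simp add: mult.assoc)
      finally have "?n * a1 \<le> U * T" using R0 by (simp add: mult.assoc[symmetric])
      then have "?n \<le> U / a1 * T" using pos by (simp add: pos_le_divide_eq)
      also have "\<dots> \<le> max (V / a2) (U / a1) * T" using T0 by (intro mult_right_mono) auto
      finally have up: "?n \<le> max (V / a2) (U / a1) * T" .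
      have "V * \<delta> ^ CARD('n) * Q \<le> ?n * (a2 * R)"
        unfolding a2_def R_def V_def
      proof (rule count_lower[OF \<delta>(1,2) Q4(1) refl refl])
        let ?L = "nat \<lceil>4 * ?k\<^sup>2 / \<delta>\<rceil>"
        have "4 * ?k\<^sup>2 / \<delta> \<ge> 0" using \<delta> by simp
        then have "real ?L \<le> 4 * ?k\<^sup>2 / \<delta> + 1" by linarith
        then have "real (2 * ?L) + 1 \<le> 8 * (?k\<^sup>2 / \<delta>) + 3" by simp
        moreover have "1 \<le> ?k\<^sup>2" using k1 by simp
        then have "\<delta> \<le> ?k\<^sup>2" using \<delta> by linarith
        then have "1 \<le> ?k\<^sup>2 / \<delta>" using \<delta> by simp
        ultimately have "real (2 * ?L) + 1 \<le> 11 * (?k\<^sup>2 / \<delta>)" by linarith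
        then show "freq_sum Q (real (2 * ?L)) \<le> 1 / (32 * 3 ^ CARD('n)) * Q"
          using Qb[OF Q4(3) \<delta>(1,3), of "2 * ?L"] by simp
      qed
      then have "V * T * R \<le> ?n * a2 * R" using id by (simp add: mult.assoc)
      then have "V * T \<le> ?n * a2" using R0 by simp
      then have "V / a2 * T \<le> ?n" using pos by (simp add: pos_divide_le_eq)
      with up show ?thesis by (simp add: T_def mult.assoc)
    qed
    show "\<exists>Q0\<ge>1. \<exists>C1 C2. 0 < C1 \<and> C1 \<le> C2 \<and>
      (\<forall>Q \<delta>. Q \<ge> Q0 \<longrightarrow> 0 < \<delta> \<longrightarrow> \<delta> < 1 \<longrightarrow> \<delta> \<ge> c * Q powr (- \<eta> - 1 / ?k) \<longrightarrow>
      C1 * \<delta> powr (?k - kap) * Q powr (kap + 1) \<le> real (card (rat_points_near K Q \<delta>)) \<and>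
      real (card (rat_points_near K Q \<delta>)) \<le> C2 * \<delta> powr (?k - kap) * Q powr (kap + 1))"
      by (rule exI[of _ "max 4 (max Qa Qb)"], rule conjI, simp, rule exI[of _ "V / a2"],
          rule exI[of _ "max (V / a2) (U / a1)"]) (use main pos in auto)
  qed
qed

end

theorem theorem1p12:
  fixes b :: nat and D :: "(nat ^ 'n) set"
  assumes "b \<ge> 2"
    and "D \<noteq> {}"
    and "\<forall>d\<in>D. \<forall>i. d $ i < b"
    and "proper_fractal (missing_digit_fractal b D)"
    and "l1_dim (cantor_lebesgue b D) > real CARD('n) - real CARD('n) / (real CARD('n) + 1)"
  shows "\<exists>\<eta>>0. \<forall>c>0. \<exists>Q0\<ge>1. \<exists>C1 C2. 0 < C1 \<and> C1 \<le> C2 \<and>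
    (\<forall>Q \<delta>. Q \<ge> Q0 \<longrightarrow> 0 < \<delta> \<longrightarrow> \<delta> < 1 \<longrightarrow> \<delta> \<ge> c * Q powr (- \<eta> - 1 / real CARD('n)) \<longrightarrow>
      C1 * \<delta> powr (real CARD('n) - hausdorff_dim (missing_digit_fractal b D))
         * Q powr (hausdorff_dim (missing_digit_fractal b D) + 1)
        \<le> real (card (rat_points_near (missing_digit_fractal b D) Q \<delta>)) \<and>
      real (card (rat_points_near (missing_digit_fractal b D) Q \<delta>))
        \<le> C2 * \<delta> powr (real CARD('n) - hausdorff_dim (missing_digit_fractal b D))
         * Q powr (hausdorff_dim (missing_digit_fractal b D) + 1))"
proof -
  interpret missing_digits b D by unfold_locales (use assms in auto)
  show ?thesis
    unfolding hausdorff_dim_K[OF kap_pos[OF assms(4)]] by (rule count_bounds[OF assms(5)])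
qed

end
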